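(* Assume that the components of $\mathbf{c}$ are independently distributed and that the distribution of each component $\mathbf{c}_i$ is given by oracles for its cumulative distribution function and its quantile function. Then there exists a fully pseudo-polynomial time additive approximation scheme for Problem (SP).
   Context: Problem (SP), the stochastic bilevel continuous knapsack problem, is: maximize $\mathbb{E}_{\mathbf{c}}(d^\top x^{\mathbf{c}} - \delta b)$ over $b \in [b^-, b^+]$, where for each realization $c$ of the random vector $\mathbf{c}$ the follower's solution $x^{c}$ is an optimal solution of $\max\{c^\top x : a^\top x \le b,\ x \in [0,1]^n\}$. Here $a \in \mathbb{N}^n$ with $a>0$ are item sizes, $d \in \mathbb{Z}^n$ are the leader's item values, $\delta \ge 0$, and $0 \le b^- \le b^+ \le A := \sum_{i=1}^n a_i$. It is assumed that $\mathbb{P}(\mathbf{c}_i/a_i = \mathbf{c}_j/a_j) = 0$ for $i \ne j$ and $\mathbb{P}(\mathbf{c}_i = 0) = 0$. The cumulative distribution function is $F_{\mathbf{c}_i}(\gamma) = \mathbb{P}(\mathbf{c}_i \le \gamma)$ and the quantile function is $Q_{\mathbf{c}_i}(p) = \inf\{\gamma : p \le F_{\mathbf{c}_i}(\gamma)\}$; oracle queries are assumed to take constant time. *)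

theory Defs
  imports "HOL-Probability.Probability" "HOL-Computational_Algebra.Polynomial"
begin

section \<open>The stochastic bilevel continuous knapsack problem\<close>

text \<open>Items are numbered from 0, and a vector of length n is a function on the naturals of which
  only the values at arguments below n matter. The random vector is represented by its joint
  distribution, a probability measure on the product Borel space over the index set {..<n}: its
  elements are the realizations, and the i-th component is the i-th coordinate function.\<close>

record sp_data =
  sp_n :: nat
  sp_a :: "nat \<Rightarrow> nat"
  sp_d :: "nat \<Rightarrow> int"
  sp_delta :: real
  sp_bmin :: real
  sp_bmax :: real
  sp_law :: "(nat \<Rightarrow> real) measure"

definition sp_valid :: "sp_data \<Rightarrow> bool" where
  "sp_valid I \<longleftrightarrow>
     (\<forall>i<sp_n I. 0 < sp_a I i) \<and>
     0 \<le> sp_delta I \<and>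
     0 \<le> sp_bmin I \<and> sp_bmin I \<le> sp_bmax I \<and>
     sp_bmax I \<le> (\<Sum>i<sp_n I. real (sp_a I i)) \<and>
     prob_space (sp_law I) \<and>
     sets (sp_law I) = sets (Pi\<^sub>M {..<sp_n I} (\<lambda>_. borel)) \<and>
     (\<forall>i<sp_n I. \<forall>j<sp_n I. i \<noteq> j \<longrightarrow>
        measure (sp_law I)
          {c \<in> space (sp_law I). c i / real (sp_a I i) = c j / real (sp_a I j)} = 0) \<and>
     (\<forall>i<sp_n I. measure (sp_law I) {c \<in> space (sp_law I). c i = 0} = 0)"

definition sp_independent :: "sp_data \<Rightarrow> bool" where
  "sp_independent I \<longleftrightarrow>
     prob_space.indep_vars (sp_law I) (\<lambda>_. borel) (\<lambda>i c. c i) {..<sp_n I}"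

definition follower_feasible :: "sp_data \<Rightarrow> real \<Rightarrow> (nat \<Rightarrow> real) \<Rightarrow> bool" where
  "follower_feasible I b x \<longleftrightarrow>
     (\<Sum>i<sp_n I. real (sp_a I i) * x i) \<le> b \<and> (\<forall>i<sp_n I. x i \<in> {0..1})"

definition follower_optimal ::
  "sp_data \<Rightarrow> real \<Rightarrow> (nat \<Rightarrow> real) \<Rightarrow> (nat \<Rightarrow> real) \<Rightarrow> bool" where
  "follower_optimal I b c x \<longleftrightarrow>
     follower_feasible I b x \<and>
     (\<forall>y. follower_feasible I b y \<longrightarrow> (\<Sum>i<sp_n I. c i * y i) \<le> (\<Sum>i<sp_n I. c i * x i))"

definition follower_response :: "sp_data \<Rightarrow> (real \<Rightarrow> (nat \<Rightarrow> real) \<Rightarrow> nat \<Rightarrow> real) \<Rightarrow> bool" where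
  "follower_response I x \<longleftrightarrow>
     (\<forall>b\<in>{sp_bmin I..sp_bmax I}. \<forall>c\<in>space (sp_law I). follower_optimal I b c (x b c))"

text \<open>The follower's optimal solution is unique outside a null set, on which the response may be an
  arbitrary, possibly non-measurable, selection. Integrating with respect to the completed measure
  makes the expectation meaningful for every selection; on functions measurable with respect to
  the law itself it is the ordinary expectation.\<close>

definition leader_value ::
  "sp_data \<Rightarrow> (real \<Rightarrow> (nat \<Rightarrow> real) \<Rightarrow> nat \<Rightarrow> real) \<Rightarrow> real \<Rightarrow> real" where
  "leader_value I x b =
     (\<integral>c. (\<Sum>i<sp_n I. real_of_int (sp_d I i) * x b c i) - sp_delta I * b
        \<partial>completion (sp_law I))"

definition sp_additive_approx :: "sp_data \<Rightarrow> real \<Rightarrow> real \<Rightarrow> bool" where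
  "sp_additive_approx I \<epsilon> b \<longleftrightarrow>
     b \<in> {sp_bmin I..sp_bmax I} \<and>
     (\<forall>x. follower_response I x \<longrightarrow>
        (\<forall>b'\<in>{sp_bmin I..sp_bmax I}. leader_value I x b' - \<epsilon> \<le> leader_value I x b))"


section \<open>Distribution oracles\<close>

definition component_law :: "sp_data \<Rightarrow> nat \<Rightarrow> real measure" where
  "component_law I i = distr (sp_law I) borel (\<lambda>c. c i)"

definition quantile :: "real measure \<Rightarrow> real \<Rightarrow> ereal" where
  "quantile D p = Inf (ereal ` {\<gamma>. p \<le> cdf D \<gamma>})"


section \<open>A real random access machine with oracles\<close>

text \<open>Memory consists of integer arrays and real arrays, indexed by integers; a scalar is the cell
  with index 0 of an array. Integers support addition, subtraction and comparison, reals the four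
  field operations and comparison. Integers can be converted to reals, but there is no conversion
  (floor, rounding) from reals to integers and there are no real constants in programs: either
  would make unit cost real arithmetic unreasonably powerful.\<close>

type_synonym vname = string

datatype iexp =
    ICon int
  | IGet vname iexp
  | IAdd iexp iexp
  | ISub iexp iexp

datatype rexp =
    ROf iexp
  | RGet vname iexp
  | RAdd rexp rexp
  | RSub rexp rexp
  | RMul rexp rexp
  | RDiv rexp rexp

datatype test =
    ILe iexp iexp
  | RLe rexp rexp
  | TNot test
  | TAnd test test

datatype com =
    Skip
  | ISet vname iexp iexp
  | RSet vname iexp rexp
  | AskCdf vname iexp iexp rexp
  | AskQuantile vname iexp iexp rexp
  | Seq com com
  | Cond test com com
  | While test com

record mem =
  imem :: "vname \<Rightarrow> int \<Rightarrow> int"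
  rmem :: "vname \<Rightarrow> int \<Rightarrow> real"

primrec ival :: "mem \<Rightarrow> iexp \<Rightarrow> int" where
  "ival s (ICon k) = k"
| "ival s (IGet x e) = imem s x (ival s e)"
| "ival s (IAdd e f) = ival s e + ival s f"
| "ival s (ISub e f) = ival s e - ival s f"

primrec rval :: "mem \<Rightarrow> rexp \<Rightarrow> real" where
  "rval s (ROf e) = real_of_int (ival s e)"
| "rval s (RGet x e) = rmem s x (ival s e)"
| "rval s (RAdd e f) = rval s e + rval s f"
| "rval s (RSub e f) = rval s e - rval s f"
| "rval s (RMul e f) = rval s e * rval s f"
| "rval s (RDiv e f) = rval s e / rval s f"

primrec tval :: "mem \<Rightarrow> test \<Rightarrow> bool" where
  "tval s (ILe e f) \<longleftrightarrow> ival s e \<le> ival s f"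
| "tval s (RLe e f) \<longleftrightarrow> rval s e \<le> rval s f"
| "tval s (TNot t) \<longleftrightarrow> \<not> tval s t"
| "tval s (TAnd t u) \<longleftrightarrow> tval s t \<and> tval s u"

primrec icost :: "iexp \<Rightarrow> nat" where
  "icost (ICon k) = 1"
| "icost (IGet x e) = icost e + 1"
| "icost (IAdd e f) = icost e + icost f + 1"
| "icost (ISub e f) = icost e + icost f + 1"

primrec rcost :: "rexp \<Rightarrow> nat" where
  "rcost (ROf e) = icost e + 1"
| "rcost (RGet x e) = icost e + 1"
| "rcost (RAdd e f) = rcost e + rcost f + 1"
| "rcost (RSub e f) = rcost e + rcost f + 1"
| "rcost (RMul e f) = rcost e + rcost f + 1"
| "rcost (RDiv e f) = rcost e + rcost f + 1"

primrec tcost :: "test \<Rightarrow> nat" where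
  "tcost (ILe e f) = icost e + icost f + 1"
| "tcost (RLe e f) = rcost e + rcost f + 1"
| "tcost (TNot t) = tcost t + 1"
| "tcost (TAnd t u) = tcost t + tcost u + 1"

definition iput :: "vname \<Rightarrow> int \<Rightarrow> int \<Rightarrow> mem \<Rightarrow> mem" where
  "iput x k v s = s\<lparr>imem := (imem s)(x := (imem s x)(k := v))\<rparr>"

definition rput :: "vname \<Rightarrow> int \<Rightarrow> real \<Rightarrow> mem \<Rightarrow> mem" where
  "rput x k v s = s\<lparr>rmem := (rmem s)(x := (rmem s x)(k := v))\<rparr>"

text \<open>\<open>exec I P s t s'\<close>: started in memory s, program P halts after t steps in memory s'. The
  problem data are accessed only through the oracle commands, in which the arguments are the target
  array, the target index, the item, and the point of evaluation. Execution is stuck on a query for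
  a non-existing item or a quantile that is not a real number.\<close>

inductive exec :: "sp_data \<Rightarrow> com \<Rightarrow> mem \<Rightarrow> nat \<Rightarrow> mem \<Rightarrow> bool" for I where
  Skip: "exec I Skip s 1 s"
| ISet: "exec I (ISet x k e) s (icost k + icost e + 1) (iput x (ival s k) (ival s e) s)"
| RSet: "exec I (RSet x k e) s (icost k + rcost e + 1) (rput x (ival s k) (rval s e) s)"
| AskCdf: "ival s j = int i \<Longrightarrow> i < sp_n I \<Longrightarrow>
    exec I (AskCdf x k j e) s (icost k + icost j + rcost e + 1)
      (rput x (ival s k) (cdf (component_law I i) (rval s e)) s)"
| AskQuantile: "ival s j = int i \<Longrightarrow> i < sp_n I \<Longrightarrow>
    quantile (component_law I i) (rval s e) = ereal q \<Longrightarrow>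
    exec I (AskQuantile x k j e) s (icost k + icost j + rcost e + 1)
      (rput x (ival s k) q s)"
| Seq: "exec I P s t s' \<Longrightarrow> exec I R s' u s'' \<Longrightarrow> exec I (Seq P R) s (t + u) s''"
| CondTrue: "tval s b \<Longrightarrow> exec I P s t s' \<Longrightarrow> exec I (Cond b P R) s (tcost b + t + 1) s'"
| CondFalse: "\<not> tval s b \<Longrightarrow> exec I R s t s' \<Longrightarrow> exec I (Cond b P R) s (tcost b + t + 1) s'"
| WhileFalse: "\<not> tval s b \<Longrightarrow> exec I (While b P) s (tcost b + 1) s"
| WhileTrue: "tval s b \<Longrightarrow> exec I P s t s' \<Longrightarrow> exec I (While b P) s' u s'' \<Longrightarrow>
    exec I (While b P) s (tcost b + t + u + 1) s''"

inductive_cases exec_SkipE: "exec I Skip s t s'"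
inductive_cases exec_ISetE: "exec I (ISet x k e) s t s'"
inductive_cases exec_RSetE: "exec I (RSet x k e) s t s'"
inductive_cases exec_AskCdfE: "exec I (AskCdf x k j e) s t s'"
inductive_cases exec_AskQuantileE: "exec I (AskQuantile x k j e) s t s'"
inductive_cases exec_SeqE: "exec I (Seq P R) s t s'"
inductive_cases exec_CondE: "exec I (Cond b P R) s t s'"
inductive_cases exec_WhileE: "exec I (While b P) s t s'"

lemma exec_deterministic:
  "exec I P s t s' \<Longrightarrow> exec I P s u s'' \<Longrightarrow> t = u \<and> s' = s''"
proof (induction arbitrary: u s'' rule: exec.induct)
  case (Skip s)
  then show ?case by (rule exec_SkipE) simp
next
  case (ISet x k e s)
  then show ?case by (rule exec_ISetE) simp
next
  case (RSet x k e s)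
  then show ?case by (rule exec_RSetE) simp
next
  case (AskCdf s j i x k e)
  from AskCdf.prems show ?case by (rule exec_AskCdfE) (use AskCdf.hyps in simp)
next
  case (AskQuantile s j i e q x k)
  from AskQuantile.prems show ?case by (rule exec_AskQuantileE) (use AskQuantile.hyps in simp)
next
  case (Seq P s t s' R v s3)
  from Seq.prems show ?case by (rule exec_SeqE) (use Seq.IH in metis)
next
  case (CondTrue s b P t s' R)
  from CondTrue.prems show ?case
    by (rule exec_CondE) (use CondTrue.hyps(1) in \<open>auto dest!: CondTrue.IH\<close>)
next
  case (CondFalse s b R t s' P)
  from CondFalse.prems show ?case
    by (rule exec_CondE) (use CondFalse.hyps(1) in \<open>auto dest!: CondFalse.IH\<close>)
next
  case (WhileFalse s b P)
  from WhileFalse.prems show ?case by (rule exec_WhileE) (use WhileFalse.hyps in simp_all)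
next
  case (WhileTrue s b P t s' v s3)
  from WhileTrue.prems show ?case
    by (rule exec_WhileE) (use WhileTrue.hyps(1) in \<open>auto dest!: WhileTrue.IH\<close>)
qed

definition sp_input :: "sp_data \<Rightarrow> real \<Rightarrow> mem" where
  "sp_input I \<epsilon> =
     \<lparr>imem = (\<lambda>_ _. 0)
        (''n'' := (\<lambda>k. if k = 0 then int (sp_n I) else 0),
         ''a'' := (\<lambda>k. if 0 \<le> k \<and> k < int (sp_n I) then int (sp_a I (nat k)) else 0),
         ''d'' := (\<lambda>k. if 0 \<le> k \<and> k < int (sp_n I) then sp_d I (nat k) else 0)),
      rmem = (\<lambda>_ _. 0)
        (''delta'' := (\<lambda>k. if k = 0 then sp_delta I else 0),
         ''bmin'' := (\<lambda>k. if k = 0 then sp_bmin I else 0),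
         ''bmax'' := (\<lambda>k. if k = 0 then sp_bmax I else 0),
         ''eps'' := (\<lambda>k. if k = 0 then \<epsilon> else 0))\<rparr>"

definition sp_output :: "mem \<Rightarrow> real" where
  "sp_output s = rmem s ''b'' 0"


section \<open>Fully pseudo-polynomial time additive approximation schemes\<close>

text \<open>Pseudo-polynomial running time refers to the numerical values of the input rather than to
  their encoding lengths. A polynomial in the sum of these nonnegative quantities is the same as a
  polynomial in all of them, up to an upper bound.\<close>

definition sp_magnitude :: "sp_data \<Rightarrow> real" where
  "sp_magnitude I =
     real (sp_n I) + (\<Sum>i<sp_n I. real (sp_a I i)) + (\<Sum>i<sp_n I. \<bar>real_of_int (sp_d I i)\<bar>)
     + sp_delta I + sp_bmin I + sp_bmax I"

definition fully_pseudo_poly_additive_scheme :: "sp_data set \<Rightarrow> com \<Rightarrow> bool" where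
  "fully_pseudo_poly_additive_scheme \<I> P \<longleftrightarrow>
     (\<exists>p :: real poly. \<forall>I\<in>\<I>. \<forall>\<epsilon>>0. \<exists>t s.
        exec I P (sp_input I \<epsilon>) t s \<and>
        real t \<le> poly p (sp_magnitude I + 1 / \<epsilon>) \<and>
        sp_additive_approx I \<epsilon> (sp_output s))"

end

theory Submission
  imports Defs
begin

text \<open>For almost every realization the follower's solution is unique and greedy: item i with c_i > 0
  receives the fraction (b - S) / a_i, clipped to [0, 1], where S is the total size of the
  items with a better ratio c_j / a_j. As S and a_i are integers, the leader's expected value is
  affine between consecutive integers, so only the integers, clipped to [b^-, b^+], are candidates.

  Conditioned on c_i = \<gamma>, the expected fraction of item i is an expectation over a sum of
  independent weighted Bernoulli variables, which a dynamic program over the capacities computes from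
  values of the distribution functions. It is monotone in \<gamma> with values in [0, 1]; hence averaging
  it over the (k/K)-quantiles of c_i approximates its integral with error at most 1/K, whatever the
  distribution. Taking K > 2 (|d_1| + ... + |d_n|) / \<epsilon> makes the best candidate \<epsilon>-optimal.\<close>

text \<open>Discretising the values of c_i themselves would give an error that depends on the
  distribution, which may be unbounded or have atoms. Equidistant probability levels avoid this: as
  a function of the level, the share is monotone with values in [0, 1], so the step functions
  enclosing it on K cells differ in integral by 1/K. The levels 0 and 1 are left out, because their
  quantiles may be infinite and such a query gets stuck; the bounds 0 and 1 on the share replace
  them. Item i contributes an error of at most |d_i| / K, and the total error is paid twice, at the
  chosen candidate and at the one it is compared with: hence the factor 2 in the choice of K. As the
  machine cannot round, K is found by counting upwards, which is affordable because K is at most 2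
  (|d_1| + ... + |d_n|) / \<epsilon> + 1.\<close>

definition unit_clamp :: "real \<Rightarrow> real" where
  "unit_clamp x = max 0 (min 1 x)"

text \<open>The total size of the items in J that are packed before item i if \<open>c i = \<gamma>\<close>. The condition is
  \<open>c j / a j > \<gamma> / a i\<close>, written as a bound on \<open>c j\<close> so that its probability is a query to the
  distribution function.\<close>

definition load :: "sp_data \<Rightarrow> nat \<Rightarrow> real \<Rightarrow> nat set \<Rightarrow> (nat \<Rightarrow> real) \<Rightarrow> real" where
  "load I i \<gamma> J c =
     (\<Sum>j\<in>J. if \<gamma> * real (sp_a I j) / real (sp_a I i) < c j then real (sp_a I j) else 0)"

definition greedy :: "sp_data \<Rightarrow> real \<Rightarrow> (nat \<Rightarrow> real) \<Rightarrow> nat \<Rightarrow> real" where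
  "greedy I b c i =
     (if 0 < c i then unit_clamp ((b - load I i (c i) ({..<sp_n I} - {i}) c) / real (sp_a I i)) else 0)"

text \<open>The expected fraction of item i given \<open>c i = \<gamma>\<close> if the capacity s is already occupied and only
  the items below the recursion argument compete with i. Recursing on values rather than on the
  distribution of the load lets the program update one array in place.\<close>

primrec fill :: "sp_data \<Rightarrow> nat \<Rightarrow> real \<Rightarrow> real \<Rightarrow> nat \<Rightarrow> int \<Rightarrow> real" where
  "fill I i b \<gamma> 0 s = unit_clamp ((b - of_int s) / real (sp_a I i))"
| "fill I i b \<gamma> (Suc j) s =
     (if j = i then fill I i b \<gamma> j s
      else cdf (component_law I j) (\<gamma> * real (sp_a I j) / real (sp_a I i)) * fill I i b \<gamma> j s
         + (1 - cdf (component_law I j) (\<gamma> * real (sp_a I j) / real (sp_a I i)))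
           * fill I i b \<gamma> j (s + int (sp_a I j)))"

definition share :: "sp_data \<Rightarrow> nat \<Rightarrow> real \<Rightarrow> real \<Rightarrow> real" where
  "share I i b \<gamma> = (if 0 < \<gamma> then fill I i b \<gamma> (sp_n I) 0 else 0)"

lemma unit_clamp_bounds: "0 \<le> unit_clamp x" "unit_clamp x \<le> 1"
  by (auto simp: unit_clamp_def)

lemma unit_clamp_mono: "x \<le> y \<Longrightarrow> unit_clamp x \<le> unit_clamp y"
  by (auto simp: unit_clamp_def)

lemma measurable_unit_clamp [measurable]: "unit_clamp \<in> borel_measurable borel"
  unfolding unit_clamp_def[abs_def] by measurable

section \<open>The follower's response\<close>

lemma sum_fun_upd_mult:
  fixes g x :: "nat \<Rightarrow> real"
  assumes "i < n"
  shows "(\<Sum>j<n. g j * (x(i := t)) j) = (\<Sum>j<n. g j * x j) + g i * (t - x i)"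
proof -
  have "(\<Sum>j<n. g j * (x(i := t)) j) = g i * t + (\<Sum>j\<in>{..<n} - {i}. g j * x j)"
    using assms by (subst sum.remove[of _ i]) (auto intro!: sum.cong)
  moreover have "(\<Sum>j<n. g j * x j) = g i * x i + (\<Sum>j\<in>{..<n} - {i}. g j * x j)"
    using assms by (subst sum.remove[of _ i]) auto
  ultimately show ?thesis by (simp add: algebra_simps)
qed

text \<open>Exchange argument: an optimal solution cannot be improved by dropping an item of
  negative value (\<open>neg\<close>), by filling slack with an item of positive value
  (\<open>full\<close>), or by moving capacity to an item with a better ratio (\<open>prio\<close>).
  These three facts leave only the greedy value.\<close>

lemma follower_optimal_eq_greedy:
  assumes a: "\<And>i. i < sp_n I \<Longrightarrow> 0 < sp_a I i"
    and ratio: "\<And>i j. i < sp_n I \<Longrightarrow> j < sp_n I \<Longrightarrow> i \<noteq> j \<Longrightarrow>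
      c i / real (sp_a I i) \<noteq> c j / real (sp_a I j)"
    and nz: "\<And>i. i < sp_n I \<Longrightarrow> c i \<noteq> 0"
    and opt: "follower_optimal I b c x"
    and i: "i < sp_n I"
  shows "x i = greedy I b c i"
proof -
  define n where "n = sp_n I"
  define a' where "a' j = real (sp_a I j)" for j
  have ap: "0 < a' j" if "j < n" for j
    using a that by (auto simp: a'_def n_def)
  have feas: "(\<Sum>j<n. a' j * x j) \<le> b" and box: "\<And>j. j < n \<Longrightarrow> 0 \<le> x j \<and> x j \<le> 1"
    using opt by (auto simp: follower_optimal_def follower_feasible_def n_def a'_def)
  have best: "(\<Sum>j<n. c j * y j) \<le> (\<Sum>j<n. c j * x j)"
    if "(\<Sum>j<n. a' j * y j) \<le> b" "\<And>j. j < n \<Longrightarrow> 0 \<le> y j \<and> y j \<le> 1" for y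
    using opt that by (auto simp: follower_optimal_def follower_feasible_def n_def a'_def)
  have neg: "x j = 0" if j: "j < n" "c j < 0" for j
  proof (rule ccontr)
    assume "x j \<noteq> 0"
    with box[OF j(1)] have "0 < x j" by auto
    have "(\<Sum>k<n. c k * (x(j := 0)) k) \<le> (\<Sum>k<n. c k * x k)"
    proof (rule best)
      show "(\<Sum>k<n. a' k * (x(j := 0)) k) \<le> b"
        using feas mult_pos_pos[OF ap[OF j(1)] \<open>0 < x j\<close>] j
        by (simp add: sum_fun_upd_mult del: fun_upd_apply)
    qed (use box in auto)
    with mult_neg_pos[OF j(2) \<open>0 < x j\<close>] j show False
      by (simp add: sum_fun_upd_mult del: fun_upd_apply)
  qed
  have full: "(\<Sum>k<n. a' k * x k) = b" if j: "j < n" "0 < c j" "x j < 1" for j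
  proof (rule ccontr)
    assume "(\<Sum>k<n. a' k * x k) \<noteq> b"
    with feas have slack: "0 < b - (\<Sum>k<n. a' k * x k)" by simp
    define t where "t = min (1 - x j) ((b - (\<Sum>k<n. a' k * x k)) / a' j)"
    have t: "0 < t" "t \<le> 1 - x j" "a' j * t \<le> b - (\<Sum>k<n. a' k * x k)"
      using slack ap[OF j(1)] j by (auto simp: t_def min_def field_simps)
    have "(\<Sum>k<n. c k * (x(j := x j + t)) k) \<le> (\<Sum>k<n. c k * x k)"
    proof (rule best)
      show "(\<Sum>k<n. a' k * (x(j := x j + t)) k) \<le> b"
        using t(3) j by (simp add: sum_fun_upd_mult del: fun_upd_apply)
    qed (use t box[of j] box j in auto)
    with mult_pos_pos[OF j(2) t(1)] j show False
      by (simp add: sum_fun_upd_mult del: fun_upd_apply)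
  qed
  have prio: "x j = 1" if jk: "j < n" "k < n" "c k / a' k < c j / a' j" "0 < x k" for j k
  proof (rule ccontr)
    assume "x j \<noteq> 1"
    with box[OF jk(1)] have lt: "x j < 1" by auto
    from jk(3) have "j \<noteq> k" by auto
    \<comment> \<open>Here \<open>t\<close> is an amount of capacity, not a fraction: moving it from
      \<open>k\<close> to \<open>j\<close> preserves the total size and changes the objective by
      \<open>t\<close> times the difference of the ratios.\<close>
    define t where "t = min (a' j * (1 - x j)) (a' k * x k)"
    have t: "0 < t" "t \<le> a' j * (1 - x j)" "t \<le> a' k * x k"
      using ap jk lt by (auto simp: t_def)
    have t2: "t / a' j \<le> 1 - x j" "t / a' k \<le> x k" "0 < t / a' j" "0 < t / a' k"
      using t ap[OF jk(1)] ap[OF jk(2)] by (auto simp: field_simps)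
    define y where "y = (x(j := x j + t / a' j))(k := x k - t / a' k)"
    have y: "(\<Sum>l<n. g l * y l) = (\<Sum>l<n. g l * x l) + g j * (t / a' j) - g k * (t / a' k)" for g
      using jk \<open>j \<noteq> k\<close> by (simp add: y_def sum_fun_upd_mult del: fun_upd_apply) (simp add: algebra_simps)
    have "(\<Sum>l<n. c l * y l) \<le> (\<Sum>l<n. c l * x l)"
    proof (rule best)
      show "(\<Sum>l<n. a' l * y l) \<le> b"
        using feas ap[OF jk(1)] ap[OF jk(2)] by (simp add: y)
      show "0 \<le> y l \<and> y l \<le> 1" if "l < n" for l
        using that t2 box[of l] box[OF jk(1)] box[OF jk(2)] jk by (auto simp: y_def)
    qed
    then have "t * (c j / a' j) \<le> t * (c k / a' k)"
      by (simp add: y mult.commute)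
    then show False
      using mult_strict_left_mono[OF jk(3) t(1)] by linarith
  qed
  have i: "i < n" using i by (simp add: n_def)
  show ?thesis
  proof (cases "0 < c i")
    case False
    with nz[of i] i have "c i < 0" by (auto simp: n_def)
    with neg[OF i] show ?thesis by (simp add: greedy_def)
  next
    case True
    define H where "H = {j \<in> {..<n} - {i}. c i / a' i < c j / a' j}"
    define L where "L = {j \<in> {..<n} - {i}. c j / a' j < c i / a' i}"
    have split: "{..<n} = insert i (H \<union> L)"
    proof -
      have "j \<in> insert i (H \<union> L)" if "j < n" for j
      proof (rule linorder_cases[of "c i / a' i" "c j / a' j"])
        assume "c i / a' i = c j / a' j"
        with ratio[of i j] i that show ?thesis by (auto simp: n_def a'_def)
      qed (use that in \<open>auto simp: H_def L_def\<close>)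
      then show ?thesis using i by (auto simp: H_def L_def)
    qed
    have HL: "finite H" "finite L" "H \<inter> L = {}" "i \<notin> H" "i \<notin> L"
      by (auto simp: H_def L_def)
    have sum_split: "(\<Sum>j<n. a' j * x j) = a' i * x i + (\<Sum>j\<in>H. a' j * x j) + (\<Sum>j\<in>L. a' j * x j)"
      unfolding split using HL by (simp add: sum.union_disjoint)
    have load: "load I i (c i) ({..<n} - {i}) c = (\<Sum>j\<in>H. a' j)"
    proof -
      have "c i * a' j / a' i < c j \<longleftrightarrow> c i / a' i < c j / a' j" if "j < n" for j
        using ap[OF that] by (simp add: field_simps)
      then show ?thesis
        unfolding load_def H_def sum.inter_filter[OF finite_Diff[OF finite_lessThan]]
        unfolding a'_def by (intro sum.cong) simp_all
    qed
    have goal: "greedy I b c i = unit_clamp ((b - (\<Sum>j\<in>H. a' j)) / a' i)"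
      using True load by (simp add: greedy_def n_def a'_def)
    have low: "(\<Sum>j\<in>L. a' j * x j) = 0" if "x i < 1"
    proof (rule sum.neutral, rule ballI)
      fix j assume j: "j \<in> L"
      then have "x j \<le> 0" using prio[of i j] that i by (force simp: L_def)
      with box[of j] j show "a' j * x j = 0" by (auto simp: L_def)
    qed
    have high: "(\<Sum>j\<in>H. a' j * x j) = (\<Sum>j\<in>H. a' j)" if "0 < x i"
      using prio[of _ i] that i by (auto intro!: sum.cong simp: H_def)
    have nonneg: "0 \<le> (\<Sum>j\<in>L. a' j * x j)"
      using box ap by (auto intro!: sum_nonneg mult_nonneg_nonneg simp: L_def less_imp_le)
    \<comment> \<open>Only in the fractional case is the capacity split exactly. If
      \<open>x i = 0\<close>, better items may be fractional, and if \<open>x i = 1\<close>, worse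
      items may be packed; then only an inequality for \<open>b\<close> is available, which suffices
      because the clamp is saturated.\<close>
    consider "x i = 0" | "x i = 1" | "0 < x i" "x i < 1"
      using box[OF i] by fastforce
    then show ?thesis
    proof cases
      case 1
      have "b = (\<Sum>j\<in>H. a' j * x j)"
        using full[OF i True] 1 low sum_split by simp
      also have "\<dots> \<le> (\<Sum>j\<in>H. a' j)"
        using box ap by (intro sum_mono mult_left_le) (auto simp: H_def less_imp_le)
      finally show ?thesis
        using 1 ap[OF i] by (simp add: goal unit_clamp_def max_def min_def field_simps)
    next
      case 2
      have "a' i + (\<Sum>j\<in>H. a' j) \<le> b"
        using feas 2 high nonneg sum_split by simp
      then show ?thesis
        using 2 ap[OF i] by (simp add: goal unit_clamp_def max_def min_def field_simps)
    next
      case 3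
      have "b = a' i * x i + (\<Sum>j\<in>H. a' j)"
        using full[OF i True 3(2)] high[OF 3(1)] low[OF 3(2)] sum_split by simp
      then have "(b - (\<Sum>j\<in>H. a' j)) / a' i = x i"
        using ap[OF i] by (simp add: field_simps)
      then show ?thesis
        using 3 by (simp add: goal unit_clamp_def)
    qed
  qed
qed

section \<open>Affine pieces\<close>

text \<open>The breakpoints \<open>S\<close> and \<open>S + k\<close> are integers, so a single
  branch of the clamp is valid on all of [m, m + 1]. The points \<open>u\<close> and
  \<open>v\<close> are arbitrary in this interval because clipped candidates need not be
  integers.\<close>

lemma unit_clamp_affine_between_integers:
  fixes m S k :: int
  assumes "0 < k" and u: "u \<in> {of_int m..of_int m + 1}" and v: "v \<in> {of_int m..of_int m + 1}"
    and t: "0 \<le> t" "t \<le> 1"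
  shows "unit_clamp (((1 - t) * u + t * v - of_int S) / of_int k) =
    (1 - t) * unit_clamp ((u - of_int S) / of_int k) + t * unit_clamp ((v - of_int S) / of_int k)"
proof -
  define w where "w = (1 - t) * u + t * v"
  have w: "w \<in> {of_int m..of_int m + 1}"
    unfolding w_def using convexD[OF convex_closed_interval u v, of "1 - t" t] t 
    by simp
  have k: "0 < real_of_int k" using assms by simp
  consider "m + 1 \<le> S" | "S \<le> m" "m + 1 \<le> S + k" | "S + k \<le> m" by linarith
  then have "unit_clamp ((w - of_int S) / of_int k) =
    (1 - t) * unit_clamp ((u - of_int S) / of_int k) + t * unit_clamp ((v - of_int S) / of_int k)"
  proof cases
    case 1
    then have "real_of_int m + 1 \<le> of_int S" by linarith
    then have "unit_clamp ((z - of_int S) / of_int k) = 0"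
      if "z \<in> {of_int m..of_int m + 1}" for z
      using that k by (auto simp: unit_clamp_def divide_nonpos_pos)
    then show ?thesis using u v w by simp
  next
    case 2
    then have "of_int S \<le> real_of_int m" "real_of_int m + 1 \<le> of_int S + of_int k"
      by linarith+
    then have "unit_clamp ((z - of_int S) / of_int k) = (z - of_int S) / of_int k"
      if "z \<in> {of_int m..of_int m + 1}" for z
      using that k by (auto simp: unit_clamp_def max_def min_def divide_simps)
    then have *: "unit_clamp ((u - of_int S) / of_int k) = (u - of_int S) / of_int k"
      "unit_clamp ((v - of_int S) / of_int k) = (v - of_int S) / of_int k"
      "unit_clamp ((w - of_int S) / of_int k) = (w - of_int S) / of_int k"
      using u v w by auto
    show ?thesis unfolding * unfolding w_def using k by (simp add: field_simps)
  next
    case 3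
    then have "of_int S + of_int k \<le> real_of_int m" by linarith
    then have "unit_clamp ((z - of_int S) / of_int k) = 1"
      if "z \<in> {of_int m..of_int m + 1}" for z
      using that k by (auto simp: unit_clamp_def max_def min_def divide_simps)
    then show ?thesis using u v w by simp
  qed
  then show ?thesis by (simp add: w_def)
qed

lemma load_integer: "\<exists>S :: int. load I i \<gamma> J c = of_int S"
  by (rule exI[of _ "\<Sum>j\<in>J. if \<gamma> * real (sp_a I j) / real (sp_a I i) < c j then int (sp_a I j) else 0"])
     (simp add: load_def of_int_sum if_distrib cong: if_cong)

lemma greedy_affine_between_integers:
  fixes m :: int
  assumes "0 < sp_a I i" "u \<in> {of_int m..of_int m + 1}" "v \<in> {of_int m..of_int m + 1}"
    "0 \<le> t" "t \<le> 1"
  shows "greedy I ((1 - t) * u + t * v) c i = (1 - t) * greedy I u c i + t * greedy I v c i"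
proof -
  obtain S :: int where S: "load I i (c i) ({..<sp_n I} - {i}) c = of_int S"
    using load_integer by blast
  show ?thesis
    using unit_clamp_affine_between_integers[OF _ assms(2,3,4,5), of "int (sp_a I i)" S] assms(1)
    by (simp add: greedy_def S)
qed

section \<open>Quantiles\<close>

text \<open>For levels strictly between 0 and 1 the Galois connection between the distribution
  function and its pseudoinverse \<open>I\<close> makes the set a closed half-line, so the infimum
  is a real number and the oracle query does not get stuck.\<close>

lemma quantile_eq_pseudoinverse:
  assumes "real_distribution M" "0 < p" "p < 1"
  shows "quantile M p = ereal (Inf {x. p \<le> cdf M x})"
proof -
  interpret cdf_distribution M using assms(1) by (simp add: cdf_distribution_def)
  have "{x. p \<le> C x} = {I p..}"
    unfolding atLeast_def by (intro Collect_cong pseudoinverse[OF assms(2,3)])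
  then have "quantile M p = Inf (ereal ` {I p..})"
    unfolding quantile_def by (rule arg_cong)
  also have "\<dots> = ereal (I p)"
    by (intro antisym Inf_lower Inf_greatest) auto
  finally show ?thesis .
qed

text \<open>\<open>M\<close> is the law of its pseudoinverse \<open>I u\<close> for \<open>u\<close>
  uniform on (0, 1), and \<open>h (I u)\<close> is monotone in \<open>u\<close>. On each of
  \<open>K\<close> equal cells it lies between its values at the two ends; the sum over right ends
  is the sum over left ends shifted by one cell, so the two bounds differ only by the last term,
  which is at most 1.\<close>

lemma integral_mono_quantile_bounds:
  assumes M: "real_distribution M" and h: "mono h" "\<And>x. 0 \<le> h x" "\<And>x. h x \<le> 1"
    and K: "0 < K"
  defines "q \<equiv> \<lambda>k::nat. Inf {x. real k / real K \<le> cdf M x}"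
  shows "(\<Sum>k=1..<K. h (q k)) / real K \<le> (\<integral>x. h x \<partial>M)" (is ?lower)
    and "(\<integral>x. h x \<partial>M) \<le> (\<Sum>k=1..<K. h (q k)) / real K + 1 / real K" (is ?upper)
proof -
  interpret cdf_distribution M using M by (simp add: cdf_distribution_def)
  define \<Omega> where "\<Omega> = (restrict_space lborel {0<..<1} :: real measure)"
  interpret \<Omega>: prob_space \<Omega>
    unfolding \<Omega>_def
    by (auto simp add: emeasure_restrict_space space_restrict_space intro!: prob_spaceI)
  have [measurable]: "h \<in> borel_measurable borel"
    using h(1) by (rule borel_measurable_mono)
  have I_meas: "I \<in> borel_measurable \<Omega>"
    using measurable_CI unfolding \<Omega>_def
    by (simp add: measurable_def space_restrict_space sets_restrict_space)
  have sp: "space \<Omega> = {0<..<1}" by (simp add: \<Omega>_def space_restrict_space)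
  have hI: "(\<integral>x. h x \<partial>M) = (\<integral>u. h (I u) \<partial>\<Omega>)"
    by (subst distr_I_eq_M[symmetric], fold \<Omega>_def, rule integral_distr[OF I_meas]) measurable
  have int_h: "integrable \<Omega> (\<lambda>u. h (I u))"
    using h I_meas by (intro \<Omega>.integrable_const_bound[of _ 1]) auto
  \<comment> \<open>Half-open cells make \<open>k\<close> the floor of \<open>u * K\<close>; cutting
    0 off the first cell does not change its length.\<close>
  define cell where "cell k = {real k / real K..<(real k + 1) / real K} \<inter> {0<..<1}" for k
  have cell_iff: "u \<in> cell k \<longleftrightarrow> k = nat \<lfloor>u * real K\<rfloor>" if "u \<in> {0<..<1}" for u k
  proof -
    have "u \<in> cell k \<longleftrightarrow> real k \<le> u * real K \<and> u * real K < real k + 1"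
      using K that by (auto simp: cell_def field_simps)
    also have "\<dots> \<longleftrightarrow> \<lfloor>u * real K\<rfloor> = int k"
      by (simp add: floor_eq_iff)
    finally show ?thesis using that by auto
  qed
  have cell_sets [measurable]: "cell k \<in> sets \<Omega>" for k
    by (auto simp: \<Omega>_def sets_restrict_space_iff cell_def)
  have cell_meas: "measure \<Omega> (cell k) = 1 / real K" if "k < K" for k
  proof -
    have le1: "(real k + 1) / real K \<le> 1" using that K by (simp add: field_simps)
    have "measure \<Omega> (cell k) = measure lborel (cell k)"
      unfolding \<Omega>_def by (intro measure_restrict_space) (auto simp: cell_def)
    also have "\<dots> = 1 / real K"
    proof (cases "k = 0")
      case True
      then have "cell k = {0<..<1 / real K}"
        using le1 by (auto simp: cell_def)
      then show ?thesis by simp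
    next
      case False
      then have "0 < real k / real K" using K by simp
      then have "cell k = {real k / real K..<(real k + 1) / real K}"
        using le1 by (auto simp: cell_def)
      then show ?thesis using K by (simp add: field_simps)
    qed
    finally show ?thesis .
  qed
  have step_int: "integrable \<Omega> (\<lambda>u. \<Sum>k\<in>A. r k * indicator (cell (f k)) u)"
    "(\<integral>u. (\<Sum>k\<in>A. r k * indicator (cell (f k)) u) \<partial>\<Omega>) = (\<Sum>k\<in>A. r k) / real K"
    if "finite A" "\<And>k. k \<in> A \<Longrightarrow> f k < K" for A :: "nat set" and r :: "nat \<Rightarrow> real" and f
    using that cell_meas
    by (simp_all add: sum_divide_distrib less_top[symmetric] del: sum_mult_indicator)
  have step: "(\<Sum>k\<in>A. r k * indicator (cell k) u) =
      (if nat \<lfloor>u * real K\<rfloor> \<in> A then r (nat \<lfloor>u * real K\<rfloor>) else 0)"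
    if "finite A" "u \<in> {0<..<1}" for A u and r :: "nat \<Rightarrow> real"
  proof -
    have "(\<Sum>k\<in>A. r k * indicator (cell k) u) =
        (\<Sum>k\<in>A. if nat \<lfloor>u * real K\<rfloor> = k then r k else 0)"
      using cell_iff[OF that(2)] by (intro sum.cong) (auto simp: indicator_def)
    then show ?thesis using that by (simp add: sum.delta)
  qed
  have le_I: "h (q k) \<le> h (I u)" if "0 < k" "real k \<le> u * real K" "u < 1" for k u
  proof -
    have ku: "real k / real K \<le> u" "0 < real k / real K" using that K by (simp_all add: field_simps)
    have "q k \<le> I u"
      unfolding q_def by (rule mono_onD[OF mono_I]) (use ku that in auto)
    then show ?thesis by (rule monoD[OF h(1)])
  qed
  have I_le: "h (I u) \<le> h (q k)" if "0 < u" "u * real K \<le> real k" "k < K" for k u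
  proof -
    have ku: "u \<le> real k / real K" "real k / real K < 1" using that K by (simp_all add: field_simps)
    have "I u \<le> q k"
      unfolding q_def by (rule mono_onD[OF mono_I]) (use ku that in \<open>auto intro: le_less_trans\<close>)
    then show ?thesis by (rule monoD[OF h(1)])
  qed
  \<comment> \<open>Cell 0 has no summand, since its left end has no real quantile; there
    \<open>0 \<le> h\<close> is the lower bound.\<close>
  have "(\<Sum>k=1..<K. h (q k)) / real K = (\<integral>u. (\<Sum>k=1..<K. h (q k) * indicator (cell k) u) \<partial>\<Omega>)"
    by (subst step_int) auto
  also have "\<dots> \<le> (\<integral>u. h (I u) \<partial>\<Omega>)"
  proof (rule integral_mono[OF step_int(1) int_h])
    fix u assume "u \<in> space \<Omega>"
    then have u: "u \<in> {0<..<1}" by (simp add: sp)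
    show "(\<Sum>k=1..<K. h (q k) * indicator (cell k) u) \<le> h (I u)"
    proof (cases "nat \<lfloor>u * real K\<rfloor> \<in> {1..<K}")
      case True
      have "real (nat \<lfloor>u * real K\<rfloor>) \<le> u * real K" using u by (simp add: of_nat_nat)
      with True le_I[of "nat \<lfloor>u * real K\<rfloor>" u] u show ?thesis
        unfolding step[OF finite_atLeastLessThan u] by simp
    next
      case False
      then show ?thesis
        unfolding step[OF finite_atLeastLessThan u] using h(2) by (simp only: if_False)
    qed
  qed auto
  finally show ?lower by (simp add: hI)
  \<comment> \<open>Value at the right end of cell \<open>k\<close>. The right end of the last cell
    is the level 1, where the quantile may be infinite, so the bound 1 on \<open>h\<close> takes its
    place.\<close>
  define r where "r k = (if Suc k < K then h (q (Suc k)) else 1)" for k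
  have "(\<integral>u. h (I u) \<partial>\<Omega>) \<le> (\<integral>u. (\<Sum>k<K. r k * indicator (cell k) u) \<partial>\<Omega>)"
  proof (rule integral_mono[OF int_h step_int(1)])
    fix u assume "u \<in> space \<Omega>"
    then have u: "u \<in> {0<..<1}" by (simp add: sp)
    then have "u * real K < real K" using K by simp
    then have "nat \<lfloor>u * real K\<rfloor> < K" using u K by (simp add: nat_less_iff floor_less_iff)
    moreover have "u * real K \<le> real (Suc (nat \<lfloor>u * real K\<rfloor>))"
      using u K by (simp add: of_nat_nat) linarith
    ultimately have "h (I u) \<le> r (nat \<lfloor>u * real K\<rfloor>)"
      using I_le[of u "Suc (nat \<lfloor>u * real K\<rfloor>)"] u h(3) unfolding r_def by (cases "Suc (nat \<lfloor>u * real K\<rfloor>) < K") simp_all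
    then show "h (I u) \<le> (\<Sum>k<K. r k * indicator (cell k) u)"
      unfolding step[OF finite_lessThan u] using \<open>nat \<lfloor>u * real K\<rfloor> < K\<close> by simp
  qed auto
  also have "\<dots> = (\<Sum>k<K. r k) / real K"
    by (subst step_int) auto
  also have "(\<Sum>k<K. r k) = (\<Sum>k=1..<K. h (q k)) + 1"
  proof -
    obtain L where L: "K = Suc L" using K by (cases K) auto
    have "(\<Sum>k<L. r k) = (\<Sum>k<L. h (q (Suc k)))"
      by (intro sum.cong) (auto simp: r_def L)
    also have "\<dots> = (\<Sum>k=1..<K. h (q k))"
      by (simp only: L One_nat_def lessThan_atLeast0 sum.shift_bounds_Suc_ivl)
    finally show ?thesis by (simp add: L r_def)
  qed
  finally show ?upper by (simp add: hI add_divide_distrib)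
qed

section \<open>Expected shares\<close>

text \<open>The completion contains all subsets of null sets, so altering a measurable function on a
  null set keeps it measurable. This handles responses that are chosen arbitrarily where the
  follower's optimum is not unique.\<close>

lemma AE_eq_measurable_completion:
  fixes f g :: "'a \<Rightarrow> real"
  assumes g: "g \<in> borel_measurable M" and eq: "AE x in M. f x = g x"
  shows "f \<in> borel_measurable (completion M)"
proof (rule measurableI)
  fix A :: "real set" assume A: "A \<in> sets borel"
  have "g -` A \<inter> space (completion M) \<in> sets (completion M)"
    using measurable_sets[OF g A] by (auto intro: sets_completionI_sets)
  moreover have "AE x in completion M. x \<in> g -` A \<inter> space (completion M) \<longleftrightarrow> x \<in> f -` A \<inter> space (completion M)"
    using AE_completion[OF eq] by eventually_elim auto
  ultimately show "f -` A \<inter> space (completion M) \<in> sets (completion M)"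
    using completion.in_sets_AE by blast
qed simp

lemma integral_completion_AE_eq:
  fixes f g :: "'a \<Rightarrow> real"
  assumes "g \<in> borel_measurable M" "AE x in M. f x = g x"
  shows "(\<integral>x. f x \<partial>completion M) = (\<integral>x. g x \<partial>M)"
proof -
  have "(\<integral>x. f x \<partial>completion M) = (\<integral>x. g x \<partial>completion M)"
    using assms by (intro integral_cong_AE AE_eq_measurable_completion[of g] AE_completion)
      (auto intro: measurable_completion)
  also have "\<dots> = (\<integral>x. g x \<partial>M)"
    using assms(1) by (rule integral_completion)
  finally show ?thesis .
qed

section \<open>The law as the product of its marginals\<close>

locale sp_instance =
  fixes I :: sp_data
  assumes valid: "sp_valid I" and indep: "sp_independent I"
begin

abbreviation "n \<equiv> sp_n I"
abbreviation "law \<equiv> sp_law I"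
abbreviation "\<mu> \<equiv> component_law I"

definition "total_size = (\<Sum>i<n. sp_a I i)"

lemma size_pos: "i < n \<Longrightarrow> 0 < sp_a I i"
  using valid by (simp add: sp_valid_def)

lemma law_props: "prob_space law" "sets law = sets (Pi\<^sub>M {..<n} (\<lambda>_. borel))"
  using valid by (simp_all add: sp_valid_def)

sublocale law: prob_space law by (rule law_props)

lemma space_law: "space law = space (Pi\<^sub>M {..<n} (\<lambda>_. borel :: real measure))"
  using law_props(2) by (rule sets_eq_imp_space_eq)

text \<open>Realizations are extensional, so the coordinates outside the index set are constant.
  Covering them as well makes every \<open>\<mu> j\<close> a probability distribution, as the
  product measure locale demands of the whole family.\<close>

lemma measurable_coordinate: "(\<lambda>c. c j) \<in> borel_measurable law"
proof (cases "j < n")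
  case True
  then show ?thesis
    unfolding measurable_cong_sets[OF law_props(2) refl] by (intro measurable_component_singleton) simp
next
  case False
  then have "c j = undefined" if "c \<in> space law" for c
    using that by (auto simp: space_law space_PiM PiE_def extensional_def)
  then show ?thesis
    using measurable_cong[of law "\<lambda>c. c j" "\<lambda>c. undefined" borel] by simp
qed

lemma real_distribution_component: "real_distribution (\<mu> j)"
  unfolding component_law_def real_distribution_def real_distribution_axioms_def
  using law.prob_space_distr[OF measurable_coordinate] by simp

sublocale component: real_distribution "\<mu> j" for j
  by (rule real_distribution_component)

sublocale product_sigma_finite \<mu>
  by standard

lemma sets_PiM_component: "sets (Pi\<^sub>M J \<mu>) = sets (Pi\<^sub>M J (\<lambda>_. borel))"
  by (intro sets_PiM_cong) (auto simp: component_law_def)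

lemma prob_space_PiM_component: "prob_space (Pi\<^sub>M J \<mu>)"
  by (rule prob_space_PiM) (rule component.prob_space_axioms)

lemma law_eq_PiM:
  assumes "0 < n"
  shows "law = Pi\<^sub>M {..<n} \<mu>"
proof -
  have ne: "{..<n} \<noteq> {}" using assms by auto
  have "distr law (Pi\<^sub>M {..<n} (\<lambda>_. borel)) (\<lambda>c. \<lambda>i\<in>{..<n}. c i) = Pi\<^sub>M {..<n} \<mu>"
    using law.indep_vars_iff_distr_eq_PiM[OF ne, where M' = "\<lambda>_. borel" and X = "\<lambda>i c. c i"] measurable_coordinate indep
    unfolding sp_independent_def component_law_def[abs_def] by simp
  \<comment> \<open>Elements of the product space are extensional, so restricting them to
    \<open>{..<n}\<close> is the identity.\<close>
  moreover have "distr law (Pi\<^sub>M {..<n} (\<lambda>_. borel)) (\<lambda>c. \<lambda>i\<in>{..<n}. c i) = distr law law (\<lambda>c. c)"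
    by (rule distr_cong) (auto simp: law_props(2) space_law space_PiM PiE_restrict)
  ultimately show ?thesis by (simp add: distr_id)
qed

lemma measurable_load:
  assumes "J \<subseteq> J'"
  shows "(\<lambda>c. load I i \<gamma> J c) \<in> borel_measurable (Pi\<^sub>M J' \<mu>)"
proof -
  have [measurable]: "(\<lambda>c. c j) \<in> borel_measurable (Pi\<^sub>M J' \<mu>)" if "j \<in> J" for j
    unfolding measurable_cong_sets[OF sets_PiM_component refl]
    using that assms by (intro measurable_component_singleton) auto
  show ?thesis unfolding load_def by measurable
qed

text \<open>By Fubini the last coordinate can be integrated first: item \<open>m\<close> precedes
  item \<open>i\<close> with probability one minus the value of the distribution function, and then
  occupies its size; this is the recursion of \<open>fill\<close>. The capacity \<open>s\<close>
  varies in the induction because it grows by that size.\<close>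

lemma fill_eq_integral:
  "fill I i b \<gamma> m s =
    (\<integral>c. unit_clamp ((b - of_int s - load I i \<gamma> ({..<m} - {i}) c) / real (sp_a I i))
      \<partial>Pi\<^sub>M ({..<m} - {i}) \<mu>)"
proof (induction m arbitrary: s)
  case 0
  interpret Q: prob_space "Pi\<^sub>M {} \<mu>" by (rule prob_space_PiM_component)
  show ?case using Q.prob_space by (simp add: load_def)
next
  case (Suc m)
  show ?case
  proof (cases "m = i")
    case True
    then have "{..<Suc m} - {i} = {..<m} - {i}" by auto
    then show ?thesis using True Suc.IH[of s] by simp
  next
    case False
    define J where "J = {..<m} - {i}"
    define \<theta> where "\<theta> = \<gamma> * real (sp_a I m) / real (sp_a I i)"
    define g where "g s c = unit_clamp ((b - of_int s - load I i \<gamma> J c) / real (sp_a I i))"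
      for s :: int and c
    have J: "{..<Suc m} - {i} = insert m J" "m \<notin> J" "finite J"
      using False by (auto simp: J_def less_Suc_eq)
    interpret Q: prob_space "Pi\<^sub>M J \<mu>" by (rule prob_space_PiM_component)
    interpret Q': prob_space "Pi\<^sub>M (insert m J) \<mu>" by (rule prob_space_PiM_component)
    have meas: "(\<lambda>c. load I i \<gamma> J c) \<in> borel_measurable (Pi\<^sub>M J \<mu>)"
      "(\<lambda>c. load I i \<gamma> (insert m J) c) \<in> borel_measurable (Pi\<^sub>M (insert m J) \<mu>)"
      by (rule measurable_load, simp)+
    have int_g: "integrable (Pi\<^sub>M J \<mu>) (g s)" for s
      unfolding g_def using meas(1)
      by (intro Q.integrable_const_bound[of _ 1]) (auto simp: unit_clamp_bounds abs_of_nonneg)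
    have int_f: "integrable (Pi\<^sub>M (insert m J) \<mu>)
        (\<lambda>c. unit_clamp ((b - of_int s - load I i \<gamma> (insert m J) c) / real (sp_a I i)))"
      using meas(2)
      by (intro Q'.integrable_const_bound[of _ 1]) (auto simp: unit_clamp_bounds abs_of_nonneg)
    have inner: "(\<integral>y. unit_clamp ((b - of_int s - load I i \<gamma> (insert m J) (c(m := y))) / real (sp_a I i)) \<partial>\<mu> m)
        = cdf (\<mu> m) \<theta> * g s c + (1 - cdf (\<mu> m) \<theta>) * g (s + int (sp_a I m)) c" for c
    proof -
      have "load I i \<gamma> J (c(m := y)) = load I i \<gamma> J c" for y
        unfolding load_def using J(2) by (intro sum.cong) auto
      then have "load I i \<gamma> (insert m J) (c(m := y)) =
          (if \<theta> < y then real (sp_a I m) else 0) + load I i \<gamma> J c" for y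
        using J(2,3) by (simp add: load_def \<theta>_def)
      \<comment> \<open>As a function of \<open>y\<close> the integrand takes two values, with the
        switch at \<open>\<theta>\<close>. The strict inequality in \<open>load\<close> puts
        \<open>\<theta>\<close> itself on the side that \<open>cdf\<close> counts.\<close>
      then have "(\<integral>y. unit_clamp ((b - of_int s - load I i \<gamma> (insert m J) (c(m := y))) / real (sp_a I i)) \<partial>\<mu> m)
        = (\<integral>y. g (s + int (sp_a I m)) c
            + indicator {..\<theta>} y * (g s c - g (s + int (sp_a I m)) c) \<partial>\<mu> m)"
        by (intro Bochner_Integration.integral_cong)
          (auto simp: g_def indicator_def algebra_simps)
      also have "\<dots> = g (s + int (sp_a I m)) c + cdf (\<mu> m) \<theta> * (g s c - g (s + int (sp_a I m)) c)"
        using component.prob_space[of m]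
        by (subst Bochner_Integration.integral_add)
           (auto simp: cdf_def component.emeasure_eq_measure)
      finally show ?thesis by (simp add: algebra_simps)
    qed
    have "(\<integral>c. unit_clamp ((b - of_int s - load I i \<gamma> (insert m J) c) / real (sp_a I i))
        \<partial>Pi\<^sub>M (insert m J) \<mu>)
      = (\<integral>c. cdf (\<mu> m) \<theta> * g s c + (1 - cdf (\<mu> m) \<theta>) * g (s + int (sp_a I m)) c \<partial>Pi\<^sub>M J \<mu>)"
      unfolding product_integral_insert[OF J(3,2) int_f] inner ..
    also have "\<dots> = cdf (\<mu> m) \<theta> * (\<integral>c. g s c \<partial>Pi\<^sub>M J \<mu>)
        + (1 - cdf (\<mu> m) \<theta>) * (\<integral>c. g (s + int (sp_a I m)) c \<partial>Pi\<^sub>M J \<mu>)"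
      using int_g by simp
    also have "\<dots> = fill I i b \<gamma> (Suc m) s"
      using False Suc.IH[of s] Suc.IH[of "s + int (sp_a I m)"]
      by (simp add: g_def J_def \<theta>_def)
    finally show ?thesis unfolding J ..
  qed
qed

lemma share_bounds: "0 \<le> share I i b \<gamma>" "share I i b \<gamma> \<le> 1"
proof -
  interpret Q: prob_space "Pi\<^sub>M ({..<n} - {i}) \<mu>" by (rule prob_space_PiM_component)
  have "0 \<le> fill I i b \<gamma> n 0" "fill I i b \<gamma> n 0 \<le> 1"
    unfolding fill_eq_integral using measurable_load[OF order_refl, of i \<gamma> "{..<n} - {i}"]
    by (auto intro!: Q.integral_le_const Q.integrable_const_bound[of _ 1]
        simp: unit_clamp_bounds abs_of_nonneg)
  then show "0 \<le> share I i b \<gamma>" "share I i b \<gamma> \<le> 1" by (simp_all add: share_def)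
qed

text \<open>A larger \<open>\<gamma>\<close> improves the ratio of item \<open>i\<close>, so fewer
  items precede it and the load shrinks. The switch from 0 at \<open>\<gamma> = 0\<close> also goes
  upwards.\<close>

lemma mono_share:
  assumes "i < n"
  shows "mono (share I i b)"
proof (rule monoI)
  fix \<gamma> \<gamma>' :: real assume le: "\<gamma> \<le> \<gamma>'"
  interpret Q: prob_space "Pi\<^sub>M ({..<n} - {i}) \<mu>" by (rule prob_space_PiM_component)
  have load: "load I i \<gamma>' J c \<le> load I i \<gamma> J c" for J c
    unfolding load_def
  proof (rule sum_mono)
    fix j
    have "\<gamma> * real (sp_a I j) / real (sp_a I i) \<le> \<gamma>' * real (sp_a I j) / real (sp_a I i)"
      using le by (intro divide_right_mono mult_right_mono) auto
    then show "(if \<gamma>' * real (sp_a I j) / real (sp_a I i) < c j then real (sp_a I j) else 0)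
      \<le> (if \<gamma> * real (sp_a I j) / real (sp_a I i) < c j then real (sp_a I j) else 0)"
      by auto
  qed
  have int: "integrable (Pi\<^sub>M ({..<n} - {i}) \<mu>)
      (\<lambda>c. unit_clamp ((b - of_int 0 - load I i \<gamma> ({..<n} - {i}) c) / real (sp_a I i)))" for \<gamma>
    using measurable_load[OF order_refl, of i \<gamma> "{..<n} - {i}"]
    by (intro Q.integrable_const_bound[of _ 1]) (auto simp: unit_clamp_bounds abs_of_nonneg)
  have "fill I i b \<gamma> n 0 \<le> fill I i b \<gamma>' n 0"
    unfolding fill_eq_integral
    by (intro integral_mono int unit_clamp_mono divide_right_mono diff_left_mono load) auto
  then show "share I i b \<gamma> \<le> share I i b \<gamma>'"
    using le share_bounds(1)[of i b \<gamma>'] by (auto simp: share_def)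
qed

lemma greedy_bounds: "0 \<le> greedy I b c i" "greedy I b c i \<le> 1"
  by (simp_all add: greedy_def unit_clamp_bounds)

lemma measurable_greedy: "(\<lambda>c. greedy I b c i) \<in> borel_measurable law"
proof -
  note [measurable] = measurable_coordinate
  show ?thesis unfolding greedy_def load_def by measurable
qed

lemma integrable_greedy: "integrable law (\<lambda>c. greedy I b c i)"
  using measurable_greedy
  by (intro law.integrable_const_bound[of _ 1]) (auto simp: greedy_bounds abs_of_nonneg)

text \<open>Independence allows integrating over the competitors first with \<open>c i\<close> held
  fixed; the inner integral is then the one that \<open>fill\<close> computes.\<close>

lemma expected_greedy:
  assumes i: "i < n"
  shows "(\<integral>c. greedy I b c i \<partial>law) = (\<integral>\<gamma>. share I i b \<gamma> \<partial>\<mu> i)"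
proof -
  define J where "J = {..<n} - {i}"
  have J: "{..<n} = {i} \<union> J" "{i} \<inter> J = {}" "finite J" using i by (auto simp: J_def)
  have law: "law = Pi\<^sub>M ({i} \<union> J) \<mu>"
    using law_eq_PiM i J(1) by simp
  have "(\<integral>c. greedy I b c i \<partial>law) =
      (\<integral>x. (\<integral>y. greedy I b (merge {i} J (x, y)) i \<partial>Pi\<^sub>M J \<mu>) \<partial>Pi\<^sub>M {i} \<mu>)"
    unfolding law
    by (rule product_integral_fold[OF J(2) _ J(3)]) (use integrable_greedy law in auto)
  also have "\<dots> = (\<integral>x. share I i b (x i) \<partial>Pi\<^sub>M {i} \<mu>)"
  proof (rule Bochner_Integration.integral_cong[OF refl])
    fix x
    have "load I i \<gamma> J (merge {i} J (x, y)) = load I i \<gamma> J y" for y \<gamma>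
      unfolding load_def using J(2) by (intro sum.cong) (auto simp: merge_def)
    then have "greedy I b (merge {i} J (x, y)) i =
        (if 0 < x i then unit_clamp ((b - load I i (x i) J y) / real (sp_a I i)) else 0)" for y
      by (simp add: greedy_def J_def[symmetric] merge_def)
    then show "(\<integral>y. greedy I b (merge {i} J (x, y)) i \<partial>Pi\<^sub>M J \<mu>) = share I i b (x i)"
      by (simp add: share_def fill_eq_integral J_def[symmetric])
  qed
  also have "\<dots> = (\<integral>\<gamma>. share I i b \<gamma> \<partial>\<mu> i)"
  proof (rule product_integral_singleton)
    have "share I i b \<in> borel_measurable borel"
      using mono_share[OF i] by (rule borel_measurable_mono)
    then show "share I i b \<in> borel_measurable (\<mu> i)"
      by (simp add: component_law_def)
  qed
  finally show ?thesis .
qed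

section \<open>The leader's objective and its candidates\<close>

definition payoff :: "real \<Rightarrow> real" where
  "payoff b = (\<Sum>i<n. real_of_int (sp_d I i) * (\<integral>\<gamma>. share I i b \<gamma> \<partial>\<mu> i)) - sp_delta I * b"

text \<open>The quantifiers over \<open>x\<close> and \<open>b\<close> stand inside the almost
  everywhere statement: the exceptional set consists of ties and zeros in \<open>c\<close> alone.
  Hence the result applies to a response \<open>x b c\<close> that itself depends on the
  realization.\<close>

lemma AE_response_eq_greedy:
  "AE c in law. \<forall>x b. follower_optimal I b c x \<longrightarrow> (\<forall>i<n. x i = greedy I b c i)"
proof -
  note [measurable] = measurable_coordinate
  have "AE c in law. c i \<noteq> 0" if "i < n" for i
  proof -
    have "measure law {c \<in> space law. c i = 0} = 0"
      using valid that by (simp add: sp_valid_def)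
    then have "AE c in law. \<not> c i = 0"
      by (subst (asm) law.prob_eq_0) auto
    then show ?thesis by simp
  qed
  then have 1: "AE c in law. \<forall>i\<in>{..<n}. c i \<noteq> 0"
    by (subst AE_finite_all) auto
  have "AE c in law. c i / real (sp_a I i) \<noteq> c j / real (sp_a I j)"
    if "i < n" "j < n" "i \<noteq> j" for i j
  proof -
    have "measure law {c \<in> space law. c i / real (sp_a I i) = c j / real (sp_a I j)} = 0"
      using valid that by (simp add: sp_valid_def)
    then have "AE c in law. \<not> c i / real (sp_a I i) = c j / real (sp_a I j)"
      by (subst (asm) law.prob_eq_0) auto
    then show ?thesis by simp
  qed
  then have 2: "AE c in law. \<forall>(i,j)\<in>{(i,j). i < n \<and> j < n \<and> i \<noteq> j}.
      c i / real (sp_a I i) \<noteq> c j / real (sp_a I j)"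
    by (subst AE_finite_all) (auto intro: finite_subset[of _ "{..<n} \<times> {..<n}"])
  from 1 2 show ?thesis
    by eventually_elim (auto intro!: follower_optimal_eq_greedy size_pos)
qed

lemma leader_value_eq:
  assumes "follower_response I x" "b \<in> {sp_bmin I..sp_bmax I}"
  shows "leader_value I x b = payoff b"
proof -
  have "leader_value I x b =
      (\<integral>c. (\<Sum>i<n. real_of_int (sp_d I i) * greedy I b c i) - sp_delta I * b \<partial>law)"
    unfolding leader_value_def
  proof (rule integral_completion_AE_eq)
    show "(\<lambda>c. (\<Sum>i<n. real_of_int (sp_d I i) * greedy I b c i) - sp_delta I * b) \<in> borel_measurable law"
      using measurable_greedy by simp
    show "AE c in law. (\<Sum>i<n. real_of_int (sp_d I i) * x b c i) - sp_delta I * b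
        = (\<Sum>i<n. real_of_int (sp_d I i) * greedy I b c i) - sp_delta I * b"
      using AE_response_eq_greedy AE_space
    proof eventually_elim
      case (elim c)
      then have "follower_optimal I b c (x b c)"
        using assms by (simp add: follower_response_def)
      with elim(1) have "\<forall>i<n. x b c i = greedy I b c i" by blast
      then show ?case by simp
    qed
  qed
  also have "\<dots> = (\<Sum>i<n. real_of_int (sp_d I i) * (\<integral>c. greedy I b c i \<partial>law)) - sp_delta I * b"
    using integrable_greedy law.prob_space by simp
  finally show ?thesis using expected_greedy by (simp add: payoff_def)
qed

lemma payoff_affine_between_integers:
  fixes m :: int
  assumes "u \<in> {of_int m..of_int m + 1}" "v \<in> {of_int m..of_int m + 1}" "0 \<le> t" "t \<le> 1"
  shows "payoff ((1 - t) * u + t * v) = (1 - t) * payoff u + t * payoff v"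
proof -
  \<comment> \<open>Affinity is taken from single realizations, where it holds for
    \<open>greedy\<close>, and carried over to the shares by integration.\<close>
  have "(\<integral>\<gamma>. share I i ((1 - t) * u + t * v) \<gamma> \<partial>\<mu> i) =
      (1 - t) * (\<integral>\<gamma>. share I i u \<gamma> \<partial>\<mu> i) + t * (\<integral>\<gamma>. share I i v \<gamma> \<partial>\<mu> i)" if "i < n" for i
    unfolding expected_greedy[OF that, symmetric] greedy_affine_between_integers[OF size_pos[OF that] assms]
    using integrable_greedy by simp
  then have "payoff ((1 - t) * u + t * v) =
      (\<Sum>i<n. (1 - t) * (real_of_int (sp_d I i) * (\<integral>\<gamma>. share I i u \<gamma> \<partial>\<mu> i))
            + t * (real_of_int (sp_d I i) * (\<integral>\<gamma>. share I i v \<gamma> \<partial>\<mu> i)))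
      - sp_delta I * ((1 - t) * u + t * v)"
    by (auto simp: payoff_def distrib_left mult.left_commute intro!: sum.cong)
  also have "\<dots> = (1 - t) * payoff u + t * payoff v"
    unfolding sum.distrib sum_distrib_left[symmetric] payoff_def by (simp add: algebra_simps)
  finally show ?thesis .
qed

definition candidate :: "nat \<Rightarrow> real" where
  "candidate m = min (sp_bmax I) (max (sp_bmin I) (real m))"

lemma candidate_mem: "candidate m \<in> {sp_bmin I..sp_bmax I}"
  using valid by (auto simp: candidate_def sp_valid_def)

text \<open>An affine function on a segment is bounded by the larger of its values at the ends. The
  ends are the integers around \<open>b\<close>, clipped, so they stay in the unit interval that
  contains \<open>b\<close>.\<close>

lemma payoff_le_candidate:
  assumes b: "b \<in> {sp_bmin I..sp_bmax I}"
  shows "\<exists>m\<le>total_size. payoff b \<le> payoff (candidate m)"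
proof -
  have b': "0 \<le> b" "b \<le> real total_size" "sp_bmax I \<le> real total_size"
    using valid b by (auto simp: sp_valid_def total_size_def)
  define m where "m = nat \<lfloor>b\<rfloor>"
  have m: "real m \<le> b" "b < real m + 1"
    using b' by (auto simp: m_def)
  show ?thesis
  \<comment> \<open>At the largest possible capacity the right neighbour \<open>Suc m\<close> would
    exceed \<open>total_size\<close>, but there \<open>b\<close> is itself a candidate.\<close>
  proof (cases "b = real total_size")
    case True
    then have "candidate total_size = b" using b b' by (auto simp: candidate_def)
    then show ?thesis by (metis order_refl)
  next
    case False
    with b' m have "Suc m \<le> total_size" by linarith
    define u where "u = candidate m"
    define v where "v = candidate (Suc m)"
    have uv: "u \<le> b" "b \<le> v" "u \<in> {of_int (int m)..of_int (int m) + 1}"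
      "v \<in> {of_int (int m)..of_int (int m) + 1}"
      using b m by (auto simp: u_def v_def candidate_def)
    then obtain t where t: "0 \<le> t" "t \<le> 1" "b = (1 - t) * u + t * v"
    proof -
      have "b \<in> closed_segment u v" using uv by (simp add: closed_segment_eq_real_ivl)
      then show ?thesis using that by (auto simp: in_segment)
    qed
    then have "payoff b = (1 - t) * payoff u + t * payoff v"
      using payoff_affine_between_integers[OF uv(3,4)] by simp
    also have "\<dots> \<le> max (payoff u) (payoff v)"
      using t by (intro convex_bound_le) auto
    finally show ?thesis
      using \<open>Suc m \<le> total_size\<close> unfolding u_def v_def le_max_iff_disj by (meson Suc_leD)
  qed
qed

section \<open>Sampling the shares at quantiles\<close>

definition estimate :: "nat \<Rightarrow> nat \<Rightarrow> real \<Rightarrow> real" where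
  "estimate K i b = (\<Sum>k=1..<K. share I i b (Inf {x. real k / real K \<le> cdf (\<mu> i) x}))"

definition approx_payoff :: "nat \<Rightarrow> real \<Rightarrow> real" where
  "approx_payoff K b = (\<Sum>i<n. real_of_int (sp_d I i) * estimate K i b / real K) - sp_delta I * b"

definition "weight = (\<Sum>i<n. \<bar>sp_d I i\<bar>)"

lemma approx_payoff_error:
  assumes "0 < K"
  shows "\<bar>payoff b - approx_payoff K b\<bar> \<le> real_of_int weight / real K"
proof -
  have "\<bar>payoff b - approx_payoff K b\<bar> =
      \<bar>\<Sum>i<n. real_of_int (sp_d I i) * ((\<integral>\<gamma>. share I i b \<gamma> \<partial>\<mu> i) - estimate K i b / real K)\<bar>"
    by (simp add: payoff_def approx_payoff_def sum_subtractf algebra_simps)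
  also have "\<dots> \<le> (\<Sum>i<n. \<bar>real_of_int (sp_d I i) * ((\<integral>\<gamma>. share I i b \<gamma> \<partial>\<mu> i) - estimate K i b / real K)\<bar>)"
    by (rule sum_abs)
  also have "\<dots> \<le> (\<Sum>i<n. \<bar>real_of_int (sp_d I i)\<bar> * (1 / real K))"
  proof (rule sum_mono)
    fix i assume "i \<in> {..<n}"
    then have i: "i < n" by simp
    have "\<bar>(\<integral>\<gamma>. share I i b \<gamma> \<partial>\<mu> i) - estimate K i b / real K\<bar> \<le> 1 / real K"
      using integral_mono_quantile_bounds[OF real_distribution_component[of i] mono_share[OF i, of b]
          share_bounds assms]
      unfolding estimate_def by linarith
    then show "\<bar>real_of_int (sp_d I i) * ((\<integral>\<gamma>. share I i b \<gamma> \<partial>\<mu> i) - estimate K i b / real K)\<bar>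
        \<le> \<bar>real_of_int (sp_d I i)\<bar> * (1 / real K)"
      unfolding abs_mult by (rule mult_left_mono) simp
  qed
  also have "\<dots> = real_of_int weight / real K"
    by (simp add: weight_def sum_divide_distrib)
  finally show ?thesis .
qed

text \<open>The estimate may be too low at the candidate that dominates \<open>b\<close> and too
  high at the chosen one; each deviation is at most \<open>weight / K\<close>, and together they are
  at most \<epsilon>.\<close>

lemma additive_approx_of_best_candidate:
  assumes K: "2 * real_of_int weight < real K * \<epsilon>" and "0 < \<epsilon>"
    and best: "\<And>m. m \<le> total_size \<Longrightarrow> approx_payoff K (candidate m) \<le> approx_payoff K (candidate m0)"
  shows "sp_additive_approx I \<epsilon> (candidate m0)"
proof -
  have "0 \<le> real_of_int weight" by (simp add: weight_def sum_nonneg)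
  \<comment> \<open>Strictness in the choice of \<open>K\<close> matters here: it excludes
    \<open>K = 0\<close> even if all leader values are zero.\<close>
  with K \<open>0 < \<epsilon>\<close> have "0 < K" by (cases K) auto
  with K have err: "2 * (real_of_int weight / real K) \<le> \<epsilon>" by (simp add: field_simps)
  have "payoff b - \<epsilon> \<le> payoff (candidate m0)" if b: "b \<in> {sp_bmin I..sp_bmax I}" for b
  proof -
    obtain m where m: "m \<le> total_size" "payoff b \<le> payoff (candidate m)"
      using payoff_le_candidate[OF b] by blast
    show ?thesis
      using m(2) best[OF m(1)] err approx_payoff_error[OF \<open>0 < K\<close>, of "candidate m"]
        approx_payoff_error[OF \<open>0 < K\<close>, of "candidate m0"] by linarith
  qed
  then show ?thesis
    using candidate_mem leader_value_eq by (auto simp: sp_additive_approx_def)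
qed

end

section \<open>Running programs\<close>

text \<open>Total correctness with running time: the postcondition also sees the number of steps.\<close>

definition wp :: "sp_data \<Rightarrow> com \<Rightarrow> mem \<Rightarrow> (nat \<Rightarrow> mem \<Rightarrow> bool) \<Rightarrow> bool" where
  "wp I P s Q \<longleftrightarrow> (\<exists>t s'. exec I P s t s' \<and> Q t s')"

lemma wp_mono: "wp I P s Q \<Longrightarrow> (\<And>t s'. Q t s' \<Longrightarrow> R t s') \<Longrightarrow> wp I P s R"
  unfolding wp_def by blast

lemma wp_Skip: "wp I Skip s Q \<longleftrightarrow> Q 1 s"
  unfolding wp_def by (auto intro: exec.Skip[simplified] elim: exec_SkipE)

lemma wp_ISet: "wp I (ISet x k e) s Q \<longleftrightarrow> Q (icost k + icost e + 1) (iput x (ival s k) (ival s e) s)"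
  unfolding wp_def by (auto intro: exec.ISet[simplified] elim: exec_ISetE)

lemma wp_RSet: "wp I (RSet x k e) s Q \<longleftrightarrow> Q (icost k + rcost e + 1) (rput x (ival s k) (rval s e) s)"
  unfolding wp_def by (auto intro: exec.RSet[simplified] elim: exec_RSetE)

lemma wp_AskCdf:
  assumes "ival s j = int i" "i < sp_n I"
    "Q (icost k + icost j + rcost e + 1) (rput x (ival s k) (cdf (component_law I i) (rval s e)) s)"
  shows "wp I (AskCdf x k j e) s Q"
  unfolding wp_def using exec.AskCdf[OF assms(1,2)] assms(3) by blast

lemma wp_AskQuantile:
  assumes "ival s j = int i" "i < sp_n I" "quantile (component_law I i) (rval s e) = ereal q"
    "Q (icost k + icost j + rcost e + 1) (rput x (ival s k) q s)"
  shows "wp I (AskQuantile x k j e) s Q"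
  unfolding wp_def using exec.AskQuantile[OF assms(1-3)] assms(4) by blast

lemma wp_Seq: "wp I (Seq P R) s Q \<longleftrightarrow> wp I P s (\<lambda>t s'. wp I R s' (\<lambda>u s''. Q (t + u) s''))"
  unfolding wp_def by (blast intro: exec.Seq elim: exec_SeqE)

lemma wp_Cond:
  "wp I (Cond b P R) s Q \<longleftrightarrow>
    (if tval s b then wp I P s (\<lambda>t s'. Q (tcost b + t + 1) s')
     else wp I R s (\<lambda>t s'. Q (tcost b + t + 1) s'))"
  unfolding wp_def by (auto intro: exec.CondTrue[simplified] exec.CondFalse[simplified] elim!: exec_CondE)

text \<open>The invariant is indexed by the number of completed iterations, and their total number
  \<open>N\<close> is known in advance, so one induction on the remaining iterations yields both
  termination and the time bound.\<close>

lemma wp_While: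
  assumes "Inv 0 s"
    and step: "\<And>k s. k < N \<Longrightarrow> Inv k s \<Longrightarrow> tval s b \<and> wp I P s (\<lambda>t s'. t \<le> T \<and> Inv (Suc k) s')"
    and stop: "\<And>s. Inv N s \<Longrightarrow> \<not> tval s b"
    and Q: "\<And>t s'. Inv N s' \<Longrightarrow> t \<le> N * (T + tcost b + 1) + tcost b + 1 \<Longrightarrow> Q t s'"
  shows "wp I (While b P) s Q"
proof -
  have "\<exists>t s'. exec I (While b P) s t s' \<and> Inv N s' \<and> t \<le> j * (T + tcost b + 1) + tcost b + 1"
    if "Inv k s" "k + j = N" for k j s
    using that
  proof (induction j arbitrary: k s)
    case 0
    then show ?case using exec.WhileFalse[OF stop] by fastforce
  next
    case (Suc j)
    then have "tval s b" "wp I P s (\<lambda>t s'. t \<le> T \<and> Inv (Suc k) s')"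
      using step[of k s] by auto
    then obtain t s' where 1: "exec I P s t s'" "t \<le> T" "Inv (Suc k) s'"
      by (auto simp: wp_def)
    obtain u s'' where 2: "exec I (While b P) s' u s''" "Inv N s''"
      "u \<le> j * (T + tcost b + 1) + tcost b + 1"
      using Suc.IH[OF 1(3)] Suc.prems by auto
    show ?case
      using exec.WhileTrue[OF \<open>tval s b\<close> 1(1) 2(1)] 1(2) 2(2,3)
      by (intro exI[of _ "tcost b + t + u + 1"] exI[of _ s'']) auto
  qed
  from this[OF assms(1), of N] show ?thesis
    unfolding wp_def using Q by auto
qed

definition For :: "vname \<Rightarrow> iexp \<Rightarrow> iexp \<Rightarrow> com \<Rightarrow> com" where
  "For x lo hi P = Seq (ISet x (ICon 0) lo)
     (While (ILe (IGet x (ICon 0)) hi) (Seq P (ISet x (ICon 0) (IAdd (IGet x (ICon 0)) (ICon 1)))))"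

lemma imem_iput [simp]: "imem (iput x k v s) y = (if y = x then (imem s x)(k := v) else imem s y)"
  and rmem_iput [simp]: "rmem (iput x k v s) = rmem s"
  and rmem_rput [simp]: "rmem (rput x k w s) y = (if y = x then (rmem s x)(k := w) else rmem s y)"
  and imem_rput [simp]: "imem (rput x k w s) = imem s"
  by (simp_all add: iput_def rput_def)

text \<open>The upper limit \<open>hi\<close> is inclusive and evaluated anew at every test, so the
  invariant must determine its value; \<open>N = 0\<close> covers an empty range. The constants 10
  and 6 account for the increment, the tests and the initialisation.\<close>

lemma wp_For:
  assumes lo: "ival s lo = l" and init: "Inv 0 (iput x 0 l s)"
    and step: "\<And>k s. k < N \<Longrightarrow> Inv k s \<Longrightarrow> imem s x 0 = l + int k \<Longrightarrow>
      wp I P s (\<lambda>t s'. t \<le> T \<and> imem s' x 0 = l + int k \<and> Inv (Suc k) (iput x 0 (l + int k + 1) s'))"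
    and hi: "\<And>k s. Inv k s \<Longrightarrow> ival s hi = l + int N - 1"
    and Q: "\<And>t s'. Inv N s' \<Longrightarrow> t \<le> N * (T + icost hi + 10) + icost hi + icost lo + 6 \<Longrightarrow> Q t s'"
  shows "wp I (For x lo hi P) s Q"
  unfolding For_def wp_Seq wp_ISet
proof (rule wp_While[where N = N and T = "T + 6" and Inv = "\<lambda>k s. Inv k s \<and> imem s x 0 = l + int k"])
  fix k s assume k: "k < N" and Inv: "Inv k s \<and> imem s x 0 = l + int k"
  show "tval s (ILe (IGet x (ICon 0)) hi) \<and>
    wp I (Seq P (ISet x (ICon 0) (IAdd (IGet x (ICon 0)) (ICon 1)))) s
      (\<lambda>t s'. t \<le> T + 6 \<and> Inv (Suc k) s' \<and> imem s' x 0 = l + int (Suc k))"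
    unfolding wp_Seq using k hi[of k s] Inv
    by (auto intro!: wp_mono[OF step[of k s]] simp: wp_ISet algebra_simps)
next
  fix s assume "Inv N s \<and> imem s x 0 = l + int N"
  then show "\<not> tval s (ILe (IGet x (ICon 0)) hi)" using hi[of N s] by auto
qed (use lo init Q in \<open>auto simp: algebra_simps\<close>)

text \<open>Footprints of programs, at the granularity of whole arrays: what is known about the
  cells of a written array has to be carried by the loop invariants.\<close>

definition frame :: "vname set \<Rightarrow> vname set \<Rightarrow> mem \<Rightarrow> mem \<Rightarrow> bool" where
  "frame X Y s s' \<longleftrightarrow>
    (\<forall>x. x \<notin> X \<longrightarrow> imem s' x = imem s x) \<and> (\<forall>y. y \<notin> Y \<longrightarrow> rmem s' y = rmem s y)"

lemma frame_refl: "frame X Y s s"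
  and frame_iput: "x \<in> X \<Longrightarrow> frame X Y s s' \<Longrightarrow> frame X Y s (iput x k v s')"
  and frame_rput: "y \<in> Y \<Longrightarrow> frame X Y s s' \<Longrightarrow> frame X Y s (rput y k w s')"
  by (auto simp: frame_def)

lemma frame_trans:
  "frame X Y s s' \<Longrightarrow> frame X' Y' s' s'' \<Longrightarrow> X' \<subseteq> X \<Longrightarrow> Y' \<subseteq> Y \<Longrightarrow> frame X Y s s''"
  unfolding frame_def by (metis subset_eq)

lemma frame_imem: "frame X Y s s' \<Longrightarrow> x \<notin> X \<Longrightarrow> imem s' x = imem s x"
  and frame_rmem: "frame X Y s s' \<Longrightarrow> y \<notin> Y \<Longrightarrow> rmem s' y = rmem s y"
  by (simp_all add: frame_def)

section \<open>The algorithm\<close>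

abbreviation "iv x \<equiv> IGet x (ICon 0)"
abbreviation "rv x \<equiv> RGet x (ICon 0)"
abbreviation "iset x \<equiv> ISet x (ICon 0)"
abbreviation "rset x \<equiv> RSet x (ICon 0)"

text \<open>The array \<open>v\<close> holds the values of \<open>fill\<close> at the capacities 0, ..., A. Cells above A are read but
  never written; they hold 0, the correct value because \<open>b \<le> A\<close>.\<close>

definition cells_init :: com where
  "cells_init = For ''s'' (ICon 0) (iv ''A'')
     (Seq (RSet ''v'' (iv ''s'') (RDiv (RSub (rv ''cand'') (ROf (iv ''s''))) (ROf (IGet ''a'' (iv ''i'')))))
     (Seq (Cond (RLe (RGet ''v'' (iv ''s'')) (ROf (ICon 0))) (RSet ''v'' (iv ''s'') (ROf (ICon 0))) Skip)
          (Cond (RLe (ROf (ICon 1)) (RGet ''v'' (iv ''s''))) (RSet ''v'' (iv ''s'') (ROf (ICon 1))) Skip)))"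

text \<open>Going upwards in s, the cell \<open>s + a j\<close> still holds the value of the previous stage.\<close>

definition cells_step :: com where
  "cells_step = Seq
     (AskCdf ''F'' (ICon 0) (iv ''j'')
       (RDiv (RMul (rv ''q'') (ROf (IGet ''a'' (iv ''j'')))) (ROf (IGet ''a'' (iv ''i'')))))
     (For ''s'' (ICon 0) (iv ''A'')
       (RSet ''v'' (iv ''s'') (RAdd (RMul (rv ''F'') (RGet ''v'' (iv ''s'')))
         (RMul (RSub (ROf (ICon 1)) (rv ''F'')) (RGet ''v'' (IAdd (iv ''s'') (IGet ''a'' (iv ''j''))))))))"

abbreviation "last_item \<equiv> ISub (iv ''n'') (ICon 1)"

text \<open>The two comparisons express \<open>j = i\<close>, the item that does not compete with
  itself.\<close>

definition share_prog :: com where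
  "share_prog = Seq cells_init
     (For ''j'' (ICon 0) last_item
       (Cond (TAnd (ILe (iv ''j'') (iv ''i'')) (ILe (iv ''i'') (iv ''j''))) Skip cells_step))"

text \<open>The range 1, ..., K - 1 keeps every queried level strictly between 0 and 1. Nonpositive
  quantiles are skipped because the share vanishes there.\<close>

definition estimate_prog :: com where
  "estimate_prog = For ''k'' (ICon 1) (ISub (iv ''K'') (ICon 1))
     (Seq (AskQuantile ''q'' (ICon 0) (iv ''i'') (RDiv (ROf (iv ''k'')) (ROf (iv ''K''))))
       (Cond (RLe (rv ''q'') (ROf (ICon 0))) Skip
         (Seq share_prog (rset ''est'' (RAdd (rv ''est'') (rv ''v''))))))"

definition payoff_prog :: com where
  "payoff_prog = Seq (rset ''val'' (RSub (ROf (ICon 0)) (RMul (rv ''delta'') (rv ''cand''))))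
     (For ''i'' (ICon 0) last_item
       (Seq (rset ''est'' (ROf (ICon 0)))
       (Seq estimate_prog
         (rset ''val'' (RAdd (rv ''val'')
           (RDiv (RMul (ROf (IGet ''d'' (iv ''i''))) (rv ''est'')) (ROf (iv ''K''))))))))"

definition candidate_prog :: com where
  "candidate_prog = Seq (rset ''cand'' (ROf (iv ''m'')))
     (Seq (Cond (RLe (rv ''cand'') (rv ''bmin'')) (rset ''cand'' (rv ''bmin'')) Skip)
          (Cond (RLe (rv ''bmax'') (rv ''cand'')) (rset ''cand'' (rv ''bmax'')) Skip))"

text \<open>The first candidate is accepted unconditionally: the initial content of
  \<open>best\<close> is 0, which need not be the value of any candidate.\<close>

definition search_prog :: com where
  "search_prog = For ''m'' (ICon 0) (iv ''A'')
     (Seq candidate_prog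
     (Seq payoff_prog
       (Cond (TAnd (ILe (ICon 1) (iv ''m'')) (RLe (rv ''val'') (rv ''best''))) Skip
         (Seq (rset ''b'' (rv ''cand'')) (rset ''best'' (rv ''val''))))))"

definition totals_prog :: com where
  "totals_prog = For ''i'' (ICon 0) last_item
     (Seq (iset ''A'' (IAdd (iv ''A'') (IGet ''a'' (iv ''i''))))
       (Cond (ILe (ICon 0) (IGet ''d'' (iv ''i'')))
         (iset ''D'' (IAdd (iv ''D'') (IGet ''d'' (iv ''i''))))
         (iset ''D'' (ISub (iv ''D'') (IGet ''d'' (iv ''i''))))))"

text \<open>Linear search replaces rounding up a quotient. Its length is the resulting
  \<open>K\<close>, which the later loops run through anyway.\<close>

definition precision_prog :: com where
  "precision_prog = While (RLe (RMul (ROf (iv ''K'')) (rv ''eps'')) (ROf (IAdd (iv ''D'') (iv ''D''))))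
     (iset ''K'' (IAdd (iv ''K'') (ICon 1)))"

definition approx_prog :: com where
  "approx_prog = Seq totals_prog (Seq precision_prog search_prog)"

text \<open>The time bounds are polymorphic, so that they can be read as numbers and as polynomials.\<close>

definition cell_time :: "'a::comm_semiring_1 \<Rightarrow> 'a" where
  "cell_time A = (A + 1) * 50 + 9"

definition share_time :: "'a::comm_semiring_1 \<Rightarrow> 'a \<Rightarrow> 'a" where
  "share_time n A = cell_time A + n * (cell_time A + 42) + 11"

definition payoff_time :: "'a::comm_semiring_1 \<Rightarrow> 'a \<Rightarrow> 'a \<Rightarrow> 'a" where
  "payoff_time n A K = n * (K * (share_time n A + 38) + 45) + 21"

definition approx_time :: "'a::comm_semiring_1 \<Rightarrow> 'a \<Rightarrow> 'a \<Rightarrow> 'a" where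
  "approx_time n A K = n * 40 + 11 + (K * 20 + 20) + ((A + 1) * (payoff_time n A K + 70) + 9)"

context sp_instance
begin

text \<open>Further items only increase the occupied capacity, so nothing is left for item
  \<open>i\<close> at any stage. This is what makes the unwritten cells above A correct at every
  stage.\<close>

lemma fill_eq_0:
  assumes "i < n" "b \<le> of_int s"
  shows "fill I i b \<gamma> m s = 0"
  using assms(2)
proof (induction m arbitrary: s)
  case 0
  then show ?case using size_pos[OF assms(1)] by (simp add: unit_clamp_def divide_nonpos_pos)
next
  case (Suc m)
  then have "b \<le> of_int (s + int (sp_a I m))" by simp
  with Suc show ?case by auto
qed

definition items_loaded :: "mem \<Rightarrow> bool" where
  "items_loaded s \<longleftrightarrow> imem s ''n'' 0 = int n \<and> (\<forall>i<n. imem s ''a'' (int i) = int (sp_a I i))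
     \<and> (\<forall>i<n. imem s ''d'' (int i) = sp_d I i) \<and> imem s ''A'' 0 = int total_size"

lemma items_loaded_frame:
  "items_loaded s \<Longrightarrow> frame X Y s s' \<Longrightarrow> X \<inter> {''n'', ''a'', ''d'', ''A''} = {} \<Longrightarrow> items_loaded s'"
  unfolding items_loaded_def frame_def by (auto simp: disjoint_iff)

lemma wp_cells_init:
  assumes s: "items_loaded s" and i: "imem s ''i'' 0 = int i" "i < n"
    and b: "rmem s ''cand'' 0 = b" "b \<le> real total_size"
    and clear: "\<And>k. int total_size < k \<Longrightarrow> rmem s ''v'' k = 0"
    and Q: "\<And>t s'. t \<le> cell_time total_size \<Longrightarrow> frame {''s''} {''v''} s s' \<Longrightarrow>
      (\<And>k. 0 \<le> k \<Longrightarrow> rmem s' ''v'' k = fill I i b \<gamma> 0 k) \<Longrightarrow> Q t s'"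
  shows "wp I cells_init s Q"
  unfolding cells_init_def
\<comment> \<open>The worst case of the body is 38 steps: 14 for the quotient and 12 for each of the
  two clamping tests.\<close>
proof (rule wp_For[where l = 0 and N = "Suc total_size" and T = 38 and Inv =
      "\<lambda>m s'. frame {''s''} {''v''} s s' \<and>
        (\<forall>k. 0 \<le> k \<and> k < int m \<longrightarrow> rmem s' ''v'' k = fill I i b \<gamma> 0 k) \<and>
        (\<forall>k. int total_size < k \<longrightarrow> rmem s' ''v'' k = 0)"], goal_cases)
  case 1
  then show ?case by simp
next
  case 2
  then show ?case using clear by (simp add: frame_iput frame_refl)
next
  case (3 m s')
  then have fr: "frame {''s''} {''v''} s s'" by simp
  note [simp] = frame_imem[OF fr] frame_rmem[OF fr]
  have "imem s ''a'' (int i) = int (sp_a I i)" using s i by (simp add: items_loaded_def)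
  then show ?case
    using 3 b i
    by (auto simp: wp_Seq wp_RSet wp_Cond wp_Skip frame_iput frame_rput unit_clamp_def)
next
  case (4 m s')
  then show ?case using s by (auto simp: items_loaded_def frame_imem)
next
  case (5 t s')
  show ?case
  proof (rule Q)
    show "t \<le> cell_time total_size" using 5 by (simp add: cell_time_def)
    show "frame {''s''} {''v''} s s'" using 5 by simp
    fix k :: int assume "0 \<le> k"
    show "rmem s' ''v'' k = fill I i b \<gamma> 0 k"
    proof (cases "k \<le> int total_size")
      case False
      then have "b \<le> of_int k" using b by linarith
      with False 5 fill_eq_0[OF i(2) this, of \<gamma> 0] show ?thesis by simp
    qed (use 5 \<open>0 \<le> k\<close> in simp)
  qed
qed

lemma wp_cells_step:
  assumes s: "items_loaded s" and i: "imem s ''i'' 0 = int i" "i < n"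
    and j: "imem s ''j'' 0 = int j" "j < n" "j \<noteq> i"
    and q: "rmem s ''q'' 0 = \<gamma>" and b: "b \<le> real total_size"
    and v: "\<And>k. 0 \<le> k \<Longrightarrow> rmem s ''v'' k = fill I i b \<gamma> j k"
    and Q: "\<And>t s'. t \<le> cell_time total_size + 16 \<Longrightarrow> frame {''s''} {''v'', ''F''} s s' \<Longrightarrow>
      (\<And>k. 0 \<le> k \<Longrightarrow> rmem s' ''v'' k = fill I i b \<gamma> (Suc j) k) \<Longrightarrow> Q t s'"
  shows "wp I cells_step s Q"
proof -
  have a: "imem s ''a'' (int i) = int (sp_a I i)" "imem s ''a'' (int j) = int (sp_a I j)"
    and A: "imem s ''A'' 0 = int total_size"
    using s i j by (simp_all add: items_loaded_def)
  define F where "F = cdf (\<mu> j) (\<gamma> * real (sp_a I j) / real (sp_a I i))"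
  have fill: "fill I i b \<gamma> (Suc j) k = F * fill I i b \<gamma> j k + (1 - F) * fill I i b \<gamma> j (k + int (sp_a I j))" for k
    using j by (simp add: F_def)
  define s1 where "s1 = rput ''F'' 0 F s"
  have s1: "wp I (AskCdf ''F'' (ICon 0) (iv ''j'')
       (RDiv (RMul (rv ''q'') (ROf (IGet ''a'' (iv ''j'')))) (ROf (IGet ''a'' (iv ''i''))))) s
       (\<lambda>t s'. t \<le> 16 \<and> s' = s1)"
    by (rule wp_AskCdf[of _ _ j]) (use i j q a in \<open>simp_all add: s1_def F_def\<close>)
  have loop: "wp I (For ''s'' (ICon 0) (iv ''A'')
       (RSet ''v'' (iv ''s'') (RAdd (RMul (rv ''F'') (RGet ''v'' (iv ''s'')))
         (RMul (RSub (ROf (ICon 1)) (rv ''F'')) (RGet ''v'' (IAdd (iv ''s'') (IGet ''a'' (iv ''j'')))))))) s1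
       (\<lambda>u s'. Q (t + u) s')" if t: "t \<le> 16" for t
  \<comment> \<open>Cells below \<open>m\<close> are in the new stage, all others, also those above
    A, in the old one. Because sizes are positive, the cell at distance \<open>a j\<close> is still
    old when it is read. The bound 38 is generous here, so that both loops share
    \<open>cell_time\<close>.\<close>
  proof (rule wp_For[where l = 0 and N = "Suc total_size" and T = 38 and Inv =
      "\<lambda>m s'. frame {''s''} {''v''} s1 s' \<and>
        (\<forall>k. 0 \<le> k \<longrightarrow> rmem s' ''v'' k = (if k < int m then fill I i b \<gamma> (Suc j) k else fill I i b \<gamma> j k))"], goal_cases)
    case 1
    then show ?case by simp
  next
    case 2
    then show ?case using v by (simp add: frame_iput frame_refl s1_def del: fill.simps)
  next
    case (3 m s')
    then have fr: "frame {''s''} {''v''} s1 s'" by simp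
    note [simp] = frame_imem[OF fr] frame_rmem[OF fr]
    have "imem s1 = imem s" "rmem s1 ''F'' 0 = F" by (simp_all add: s1_def)
    then show ?case
      using 3 a i j size_pos[OF j(2)]
      by (auto simp: wp_RSet frame_iput frame_rput fill simp del: fill.simps)
  next
    case (4 m s')
    then show ?case using A by (auto simp: frame_imem s1_def)
  next
    case (5 u s')
    show ?case
    proof (rule Q)
      show "t + u \<le> cell_time total_size + 16" using 5 t by (simp add: cell_time_def)
      have "frame {''s''} {''v'', ''F''} s s1" by (simp add: s1_def frame_rput frame_refl)
      then show "frame {''s''} {''v'', ''F''} s s'" by (rule frame_trans) (use 5 in auto)
      fix k :: int assume "0 \<le> k"
      show "rmem s' ''v'' k = fill I i b \<gamma> (Suc j) k"
      proof (cases "k \<le> int total_size")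
        case False
        then have "b \<le> of_int k" using b by linarith
        with False 5 \<open>0 \<le> k\<close> fill_eq_0[OF i(2) this, of \<gamma>] show ?thesis
          by (simp del: fill.simps)
      qed (use 5 \<open>0 \<le> k\<close> in \<open>simp del: fill.simps\<close>)
    qed
  qed
  show ?thesis
    unfolding cells_step_def wp_Seq by (rule wp_mono[OF s1]) (use loop in blast)
qed

lemma wp_share_prog:
  assumes s: "items_loaded s" and i: "imem s ''i'' 0 = int i" "i < n"
    and q: "rmem s ''q'' 0 = \<gamma>" and b: "rmem s ''cand'' 0 = b" "b \<le> real total_size"
    and clear: "\<And>k. int total_size < k \<Longrightarrow> rmem s ''v'' k = 0"
    and Q: "\<And>t s'. t \<le> share_time n total_size \<Longrightarrow> frame {''s'', ''j''} {''v'', ''F''} s s' \<Longrightarrow>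
      rmem s' ''v'' 0 = fill I i b \<gamma> n 0 \<Longrightarrow>
      (\<And>k. int total_size < k \<Longrightarrow> rmem s' ''v'' k = 0) \<Longrightarrow> Q t s'"
  shows "wp I share_prog s Q"
  unfolding share_prog_def wp_Seq
proof (rule wp_cells_init[OF s i b clear, where \<gamma> = \<gamma>], assumption)
  fix t s1
  assume t: "t \<le> cell_time total_size" and fr1: "frame {''s''} {''v''} s s1"
    and v: "\<And>k. 0 \<le> k \<Longrightarrow> rmem s1 ''v'' k = fill I i b \<gamma> 0 k"
  show "wp I (For ''j'' (ICon 0) last_item
       (Cond (TAnd (ILe (iv ''j'') (iv ''i'')) (ILe (iv ''i'') (iv ''j''))) Skip cells_step)) s1
       (\<lambda>u s''. Q (t + u) s'')"
  proof (rule wp_For[where l = 0 and N = n and T = "cell_time total_size + 28" and Inv =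
      "\<lambda>m s'. frame {''s'', ''j''} {''v'', ''F''} s1 s' \<and> (\<forall>k\<ge>0. rmem s' ''v'' k = fill I i b \<gamma> m k)"],
      goal_cases)
    case 1
    then show ?case by simp
  next
    case 2
    then show ?case using v by (simp add: frame_iput frame_refl)
  next
    case (3 j s2)
    then have fr2: "frame {''s'', ''j''} {''v'', ''F''} s1 s2" by simp
    have fr: "frame {''s'', ''j''} {''v'', ''F''} s s2"
      by (rule frame_trans[OF frame_trans[OF frame_refl fr1] fr2]) auto
    note [simp] = frame_imem[OF fr] frame_rmem[OF fr]
    show ?case
    proof (cases "j = i")
      case True
      then show ?thesis using 3 i by (simp add: wp_Cond wp_Skip frame_iput)
    next
      case False
      have "wp I cells_step s2 (\<lambda>t s'. t \<le> cell_time total_size + 16 \<and>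
        frame {''s''} {''v'', ''F''} s2 s' \<and> (\<forall>k\<ge>0. rmem s' ''v'' k = fill I i b \<gamma> (Suc j) k))"
        by (rule wp_cells_step[where i = i and j = j])
           (use 3 False i q b items_loaded_frame[OF s fr] in \<open>auto simp del: fill.simps\<close>)
      then have "wp I cells_step s2 (\<lambda>t s'. tcost (TAnd (ILe (iv ''j'') (iv ''i'')) (ILe (iv ''i'') (iv ''j''))) + t + 1
          \<le> cell_time total_size + 28 \<and> imem s' ''j'' 0 = 0 + int j \<and>
        frame {''s'', ''j''} {''v'', ''F''} s1 (iput ''j'' 0 (0 + int j + 1) s') \<and>
        (\<forall>k\<ge>0. rmem (iput ''j'' 0 (0 + int j + 1) s') ''v'' k = fill I i b \<gamma> (Suc j) k))"
      proof (rule wp_mono, elim conjE, intro conjI, goal_cases)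
        case (1 t s') then show ?case by simp
      next
        case (2 t s') then show ?case using 3 by (simp add: frame_imem)
      next
        case (3 t s') then show ?case
          by (intro frame_iput frame_trans[OF fr2]) auto
      next
        case (4 t s') then show ?case by (simp del: fill.simps)
      qed
      then show ?thesis using False 3 i unfolding wp_Cond by (auto simp del: fill.simps)
    qed
  next
    case (4 m s')
    then show ?case using s by (auto simp: items_loaded_def frame_imem frame_imem[OF fr1])
  next
    case (5 u s')
    show ?case
    proof (rule Q)
      show "t + u \<le> share_time n total_size" using 5 t by (simp add: share_time_def add_ac)
      show "frame {''s'', ''j''} {''v'', ''F''} s s'"
        by (rule frame_trans[OF frame_trans[OF frame_refl fr1]]) (use 5 in auto)
      show "rmem s' ''v'' 0 = fill I i b \<gamma> n 0" using 5 by simp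
      \<comment> \<open>The array is reused for the next quantile, so the cells above A must be zero
        again on exit.\<close>
      fix k assume k: "int total_size < k"
      then have "b \<le> of_int k" using b by linarith
      with k 5 show "rmem s' ''v'' k = 0" using fill_eq_0[OF i(2)] by simp
    qed
  qed
qed

lemma wp_estimate_prog:
  assumes s: "items_loaded s" and i: "imem s ''i'' 0 = int i" "i < n"
    and K: "imem s ''K'' 0 = int K" "0 < K"
    and b: "rmem s ''cand'' 0 = b" "b \<le> real total_size"
    and est: "rmem s ''est'' 0 = 0"
    and clear: "\<And>k. int total_size < k \<Longrightarrow> rmem s ''v'' k = 0"
    and Q: "\<And>t s'. t \<le> K * (share_time n total_size + 38) + 11 \<Longrightarrow>
      frame {''s'', ''j'', ''k''} {''v'', ''F'', ''q'', ''est''} s s' \<Longrightarrow>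
      rmem s' ''est'' 0 = estimate K i b \<Longrightarrow>
      (\<And>k. int total_size < k \<Longrightarrow> rmem s' ''v'' k = 0) \<Longrightarrow> Q t s'"
  shows "wp I estimate_prog s Q"
proof -
  define X where "X = {''s'', ''j'', ''k''}"
  define Y where "Y = {''v'', ''F'', ''q'', ''est''}"
  define q where "q k = Inf {x. real k / real K \<le> cdf (\<mu> i) x}" for k
  show ?thesis
    unfolding estimate_prog_def
  proof (rule wp_For[where l = 1 and N = "K - 1" and T = "share_time n total_size + 24" and Inv =
      "\<lambda>m s'. frame X Y s s' \<and> rmem s' ''est'' 0 = (\<Sum>k=1..<Suc m. share I i b (q k)) \<and>
        (\<forall>k. int total_size < k \<longrightarrow> rmem s' ''v'' k = 0)"], goal_cases)
    case 1
    then show ?case by simp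
  next
    case 2
    then show ?case using est clear by (simp add: frame_iput frame_refl X_def)
  next
    case (3 m s1)
    then have fr: "frame X Y s s1" and est1: "rmem s1 ''est'' 0 = (\<Sum>k=1..<Suc m. share I i b (q k))"
      and clear1: "\<And>k. int total_size < k \<Longrightarrow> rmem s1 ''v'' k = 0" by auto
    note old = frame_imem[OF fr] frame_rmem[OF fr]
    define \<gamma> where "\<gamma> = q (Suc m)"
    have m: "Suc m < K" using 3 by simp
    have est_Suc: "(\<Sum>k=1..<Suc (Suc m). share I i b (q k)) = rmem s1 ''est'' 0 + share I i b \<gamma>"
      unfolding est1 \<gamma>_def by (simp add: sum.atLeastLessThan_Suc)
    define s2 where "s2 = rput ''q'' 0 \<gamma> s1"
    have fr2: "frame X Y s s2" unfolding s2_def by (rule frame_rput[OF _ fr]) (simp add: Y_def)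
    \<comment> \<open>The loop ends before \<open>K\<close>, so the level is below 1 and its
      quantile is real.\<close>
    have "quantile (\<mu> i) (real (Suc m) / real K) = ereal \<gamma>"
      unfolding \<gamma>_def q_def using m by (intro quantile_eq_pseudoinverse real_distribution_component) simp_all
    moreover have "rval s1 (RDiv (ROf (iv ''k'')) (ROf (iv ''K''))) = real (Suc m) / real K"
      using 3(3) K by (simp add: old X_def)
    ultimately have ask: "wp I (AskQuantile ''q'' (ICon 0) (iv ''i'') (RDiv (ROf (iv ''k'')) (ROf (iv ''K'')))) s1
       (\<lambda>t s'. t = 11 \<and> s' = s2)"
      using i by (intro wp_AskQuantile[of _ _ i]) (simp_all add: old X_def s2_def)
    have k2: "imem s2 ''k'' 0 = 1 + int m" using 3 by (simp add: s2_def)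
    have "wp I (Cond (RLe (rv ''q'') (ROf (ICon 0))) Skip
         (Seq share_prog (rset ''est'' (RAdd (rv ''est'') (rv ''v''))))) s2
      (\<lambda>u s'. 11 + u \<le> share_time n total_size + 24 \<and> imem s' ''k'' 0 = 1 + int m \<and>
        frame X Y s s' \<and> rmem s' ''est'' 0 = (\<Sum>k=1..<Suc (Suc m). share I i b (q k)) \<and>
        (\<forall>k. int total_size < k \<longrightarrow> rmem s' ''v'' k = 0))"
    proof (cases "0 < \<gamma>")
      case False
      then have "rmem s2 ''q'' 0 \<le> 0" by (simp add: s2_def)
      then show ?thesis
        unfolding est_Suc using fr2 k2 False clear1
        by (simp add: wp_Cond wp_Skip share_def) (simp add: s2_def)
    next
      case True
      then have "\<not> rmem s2 ''q'' 0 \<le> 0" by (simp add: s2_def)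
      moreover have "wp I share_prog s2 (\<lambda>t s'. t \<le> share_time n total_size \<and>
          frame {''s'', ''j''} {''v'', ''F''} s2 s' \<and> rmem s' ''v'' 0 = fill I i b \<gamma> n 0 \<and>
          (\<forall>k. int total_size < k \<longrightarrow> rmem s' ''v'' k = 0))"
        by (rule wp_share_prog[where i = i and b = b and \<gamma> = \<gamma>])
           (use items_loaded_frame[OF s fr2] i b clear1 in
             \<open>auto simp: X_def Y_def s2_def old\<close>)
      then have "wp I share_prog s2 (\<lambda>t s'. wp I (rset ''est'' (RAdd (rv ''est'') (rv ''v''))) s'
        (\<lambda>u s''. 11 + (tcost (RLe (rv ''q'') (ROf (ICon 0))) + (t + u) + 1) \<le> share_time n total_size + 24 \<and>
          imem s'' ''k'' 0 = 1 + int m \<and>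
          frame X Y s s'' \<and> rmem s'' ''est'' 0 = (\<Sum>k=1..<Suc (Suc m). share I i b (q k)) \<and>
          (\<forall>k. int total_size < k \<longrightarrow> rmem s'' ''v'' k = 0)))"
      proof (rule wp_mono, elim conjE)
        fix t s3
        assume t: "t \<le> share_time n total_size" and fr3: "frame {''s'', ''j''} {''v'', ''F''} s2 s3"
          and v: "rmem s3 ''v'' 0 = fill I i b \<gamma> n 0" "\<forall>k. int total_size < k \<longrightarrow> rmem s3 ''v'' k = 0"
        have fr': "frame X Y s s3"
          by (rule frame_trans[OF fr2 fr3]) (auto simp: X_def Y_def)
        have "rmem s3 ''est'' = rmem s1 ''est''"
          using frame_rmem[OF fr3] by (simp add: s2_def)
        moreover have "share I i b \<gamma> = rmem s3 ''v'' 0" using True v by (simp add: share_def)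
        ultimately show "wp I (rset ''est'' (RAdd (rv ''est'') (rv ''v''))) s3
        (\<lambda>u s''. 11 + (tcost (RLe (rv ''q'') (ROf (ICon 0))) + (t + u) + 1) \<le> share_time n total_size + 24 \<and>
          imem s'' ''k'' 0 = 1 + int m \<and>
          frame X Y s s'' \<and> rmem s'' ''est'' 0 = (\<Sum>k=1..<Suc (Suc m). share I i b (q k)) \<and>
          (\<forall>k. int total_size < k \<longrightarrow> rmem s'' ''v'' k = 0))"
          unfolding est_Suc using t v k2 frame_imem[OF fr3] frame_rput[OF _ fr']
          by (simp add: wp_RSet Y_def)
      qed
      ultimately show ?thesis unfolding wp_Cond wp_Seq by simp
    qed
    then show ?case
      unfolding wp_Seq
      by (intro wp_mono[OF ask], elim conjE, hypsubst, elim wp_mono)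
         (auto simp: X_def intro!: frame_iput)
  next
    case (4 m s')
    then show ?case using K by (auto simp: frame_imem X_def)
  next
    case (5 t s')
    show ?case
    proof (rule Q)
      have "t \<le> (K - 1) * (share_time n total_size + 38) + 11"
        using 5 by (simp add: add_ac)
      also have "\<dots> \<le> K * (share_time n total_size + 38) + 11"
        by (intro add_right_mono mult_le_mono1) simp
      finally show "t \<le> K * (share_time n total_size + 38) + 11" .
      show "rmem s' ''est'' 0 = estimate K i b"
        using 5 K by (simp add: estimate_def q_def)
    qed (use 5 in \<open>auto simp: X_def Y_def\<close>)
  qed
qed

lemma wp_payoff_prog:
  assumes s: "items_loaded s"
    and K: "imem s ''K'' 0 = int K" "0 < K"
    and b: "rmem s ''cand'' 0 = b" "b \<le> real total_size"
    and delta: "rmem s ''delta'' 0 = sp_delta I"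
    and clear: "\<And>k. int total_size < k \<Longrightarrow> rmem s ''v'' k = 0"
    and Q: "\<And>t s'. t \<le> payoff_time n total_size K \<Longrightarrow>
      frame {''s'', ''j'', ''k'', ''i''} {''v'', ''F'', ''q'', ''est'', ''val''} s s' \<Longrightarrow>
      rmem s' ''val'' 0 = approx_payoff K b \<Longrightarrow>
      (\<And>k. int total_size < k \<Longrightarrow> rmem s' ''v'' k = 0) \<Longrightarrow> Q t s'"
  shows "wp I payoff_prog s Q"
proof -
  define X where "X = {''s'', ''j'', ''k'', ''i''}"
  define Y where "Y = {''v'', ''F'', ''q'', ''est'', ''val''}"
  show ?thesis
    unfolding payoff_prog_def wp_Seq[of _ "rset ''val'' _"] wp_RSet
  \<comment> \<open>The constant 31 consists of 11 steps from \<open>estimate_prog\<close>, 4 for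
    resetting \<open>est\<close> and 16 for updating \<open>val\<close>.\<close>
  proof (rule wp_For[where l = 0 and N = n and T = "K * (share_time n total_size + 38) + 31" and Inv =
      "\<lambda>m s'. frame X Y s s' \<and>
        rmem s' ''val'' 0 = (\<Sum>i<m. real_of_int (sp_d I i) * estimate K i b / real K) - sp_delta I * b \<and>
        (\<forall>k. int total_size < k \<longrightarrow> rmem s' ''v'' k = 0)"], goal_cases)
    case 1
    then show ?case by simp
  next
    case 2
    then show ?case using clear b delta by (simp add: frame_iput frame_rput frame_refl X_def Y_def)
  next
    case (3 i s1)
    then have fr: "frame X Y s s1" by auto
    note old = frame_imem[OF fr] frame_rmem[OF fr]
    have d: "imem s ''d'' (int i) = sp_d I i" using s 3 by (simp add: items_loaded_def)
    define s2 where "s2 = rput ''est'' 0 0 s1"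
    have fr2: "frame X Y s s2" unfolding s2_def by (rule frame_rput[OF _ fr]) (simp add: Y_def)
    have "wp I estimate_prog s2 (\<lambda>t s'. t \<le> K * (share_time n total_size + 38) + 11 \<and>
        frame {''s'', ''j'', ''k''} {''v'', ''F'', ''q'', ''est''} s2 s' \<and>
        rmem s' ''est'' 0 = estimate K i b \<and> (\<forall>k. int total_size < k \<longrightarrow> rmem s' ''v'' k = 0))"
      by (rule wp_estimate_prog[where i = i and b = b and K = K])
         (use items_loaded_frame[OF s fr2] 3 K b in \<open>auto simp: X_def Y_def s2_def old\<close>)
    then have "wp I estimate_prog s2 (\<lambda>t s'. wp I (rset ''val'' (RAdd (rv ''val'')
           (RDiv (RMul (ROf (IGet ''d'' (iv ''i''))) (rv ''est'')) (ROf (iv ''K''))))) s'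
        (\<lambda>u s''. 4 + (t + u) \<le> K * (share_time n total_size + 38) + 31 \<and>
          imem s'' ''i'' 0 = 0 + int i \<and> frame X Y s (iput ''i'' 0 (0 + int i + 1) s'') \<and>
          rmem (iput ''i'' 0 (0 + int i + 1) s'') ''val'' 0 =
            (\<Sum>i<Suc i. real_of_int (sp_d I i) * estimate K i b / real K) - sp_delta I * b \<and>
          (\<forall>k. int total_size < k \<longrightarrow> rmem (iput ''i'' 0 (0 + int i + 1) s'') ''v'' k = 0)))"
    proof (rule wp_mono, elim conjE)
      fix t s3
      assume t: "t \<le> K * (share_time n total_size + 38) + 11"
        and fr3: "frame {''s'', ''j'', ''k''} {''v'', ''F'', ''q'', ''est''} s2 s3"
        and v: "rmem s3 ''est'' 0 = estimate K i b" "\<forall>k. int total_size < k \<longrightarrow> rmem s3 ''v'' k = 0"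
      have fr': "frame X Y s s3"
        by (rule frame_trans[OF fr2 fr3]) (auto simp: X_def Y_def)
      have "imem s3 ''i'' 0 = int i" "rmem s3 ''val'' = rmem s1 ''val''"
        using 3 frame_imem[OF fr3] frame_rmem[OF fr3] by (simp_all add: s2_def)
      moreover have "imem s3 ''K'' 0 = int K" "imem s3 ''d'' (int i) = sp_d I i"
        using K d frame_imem[OF fr'] by (simp_all add: X_def)
      ultimately show "wp I (rset ''val'' (RAdd (rv ''val'')
           (RDiv (RMul (ROf (IGet ''d'' (iv ''i''))) (rv ''est'')) (ROf (iv ''K''))))) s3
        (\<lambda>u s''. 4 + (t + u) \<le> K * (share_time n total_size + 38) + 31 \<and>
          imem s'' ''i'' 0 = 0 + int i \<and> frame X Y s (iput ''i'' 0 (0 + int i + 1) s'') \<and>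
          rmem (iput ''i'' 0 (0 + int i + 1) s'') ''val'' 0 =
            (\<Sum>i<Suc i. real_of_int (sp_d I i) * estimate K i b / real K) - sp_delta I * b \<and>
          (\<forall>k. int total_size < k \<longrightarrow> rmem (iput ''i'' 0 (0 + int i + 1) s'') ''v'' k = 0))"
        using t v 3 frame_iput[OF _ frame_rput[OF _ fr']] by (simp add: wp_RSet X_def Y_def)
    qed
    then show ?case
      unfolding wp_Seq wp_RSet[of _ "''est''"] by (simp add: s2_def add.assoc)
  next
    case (4 m s')
    then show ?case using s by (auto simp: frame_imem X_def items_loaded_def)
  next
    case (5 t s')
    show ?case
    proof (rule Q)
      show "icost (ICon 0) + rcost (RSub (ROf (ICon 0)) (RMul (rv ''delta'') (rv ''cand''))) + 1 + t
          \<le> payoff_time n total_size K" using 5 by (simp add: payoff_time_def add_ac)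
      show "rmem s' ''val'' 0 = approx_payoff K b"
        using 5 by (simp add: approx_payoff_def)
    qed (use 5 in \<open>auto simp: X_def Y_def\<close>)
  qed
qed

lemma wp_candidate_prog:
  assumes "rmem s ''bmin'' 0 = sp_bmin I" "rmem s ''bmax'' 0 = sp_bmax I" "imem s ''m'' 0 = int m"
    and Q: "\<And>t s'. t \<le> 25 \<Longrightarrow> frame {} {''cand''} s s' \<Longrightarrow> rmem s' ''cand'' 0 = candidate m \<Longrightarrow> Q t s'"
  shows "wp I candidate_prog s Q"
  unfolding candidate_prog_def using assms(1-3) candidate_mem[of m] valid
  by (auto simp: wp_Seq wp_RSet wp_Cond wp_Skip candidate_def sp_valid_def intro!: Q frame_rput frame_refl)

lemma wp_search_prog:
  assumes s: "items_loaded s"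
    and K: "imem s ''K'' 0 = int K" "0 < K"
    and data: "rmem s ''delta'' 0 = sp_delta I" "rmem s ''bmin'' 0 = sp_bmin I"
      "rmem s ''bmax'' 0 = sp_bmax I"
    and clear: "\<And>k. int total_size < k \<Longrightarrow> rmem s ''v'' k = 0"
    and Q: "\<And>t s' m0. t \<le> (total_size + 1) * (payoff_time n total_size K + 70) + 9 \<Longrightarrow>
      rmem s' ''b'' 0 = candidate m0 \<Longrightarrow>
      (\<And>m. m \<le> total_size \<Longrightarrow> approx_payoff K (candidate m) \<le> approx_payoff K (candidate m0)) \<Longrightarrow>
      Q t s'"
  shows "wp I search_prog s Q"
proof -
  define X where "X = {''s'', ''j'', ''k'', ''i'', ''m''}"
  define Y where "Y = {''v'', ''F'', ''q'', ''est'', ''val'', ''cand'', ''b'', ''best''}"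
  \<comment> \<open>The index \<open>m0\<close> is a ghost variable: the program stores only the
    capacity and its value. The invariant claims this only for \<open>0 < m\<close>, as nothing has
    been stored before.\<close>
  define best where "best m s' \<longleftrightarrow> (\<exists>m0. rmem s' ''b'' 0 = candidate m0 \<and>
      rmem s' ''best'' 0 = approx_payoff K (candidate m0) \<and>
      (\<forall>l<m. approx_payoff K (candidate l) \<le> approx_payoff K (candidate m0)))" for m and s' :: mem
  show ?thesis
    unfolding search_prog_def
  proof (rule wp_For[where l = 0 and N = "Suc total_size" and T = "payoff_time n total_size K + 58" and Inv =
      "\<lambda>m s'. frame X Y s s' \<and> (0 < m \<longrightarrow> best m s') \<and>
        (\<forall>k. int total_size < k \<longrightarrow> rmem s' ''v'' k = 0)"], goal_cases)
    case 1
    then show ?case by simp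
  next
    case 2
    then show ?case using clear by (simp add: frame_iput frame_refl X_def)
  next
    case (3 m s1)
    then have fr1: "frame X Y s s1" by simp
    note old = frame_imem[OF fr1] frame_rmem[OF fr1]
    show ?case
      unfolding wp_Seq
    proof (rule wp_candidate_prog[of _ m])
      show "rmem s1 ''bmin'' 0 = sp_bmin I" "rmem s1 ''bmax'' 0 = sp_bmax I" "imem s1 ''m'' 0 = int m"
        using data 3 by (simp_all add: old Y_def)
      fix t :: nat and s2
      assume t: "t \<le> 25" and fr12: "frame {} {''cand''} s1 s2" and cand: "rmem s2 ''cand'' 0 = candidate m"
      have fr2: "frame X Y s s2" by (rule frame_trans[OF fr1 fr12]) (auto simp: Y_def)
      show "wp I payoff_prog s2 (\<lambda>u s'. wp I
          (Cond (TAnd (ILe (ICon 1) (iv ''m'')) (RLe (rv ''val'') (rv ''best''))) Skip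
            (Seq (rset ''b'' (rv ''cand'')) (rset ''best'' (rv ''val'')))) s'
          (\<lambda>w s'. t + (u + w) \<le> payoff_time n total_size K + 58 \<and> imem s' ''m'' 0 = 0 + int m \<and>
            frame X Y s (iput ''m'' 0 (0 + int m + 1) s') \<and>
            (0 < Suc m \<longrightarrow> best (Suc m) (iput ''m'' 0 (0 + int m + 1) s')) \<and>
            (\<forall>k. int total_size < k \<longrightarrow> rmem (iput ''m'' 0 (0 + int m + 1) s') ''v'' k = 0)))"
      proof (rule wp_payoff_prog[OF _ _ K(2) cand])
        show "items_loaded s2" by (rule items_loaded_frame[OF s fr2]) (simp add: X_def)
        show "imem s2 ''K'' 0 = int K" "rmem s2 ''delta'' 0 = sp_delta I"
          using K data by (simp_all add: frame_imem[OF fr2] frame_rmem[OF fr2] X_def Y_def)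
        show "candidate m \<le> real total_size"
          using valid by (auto simp: candidate_def sp_valid_def total_size_def)
        show "rmem s2 ''v'' k = 0" if "int total_size < k" for k
          using that 3 by (simp add: frame_rmem[OF fr12])
        fix u s3
        assume u: "u \<le> payoff_time n total_size K"
          and fr23: "frame {''s'', ''j'', ''k'', ''i''} {''v'', ''F'', ''q'', ''est'', ''val''} s2 s3"
          and val: "rmem s3 ''val'' 0 = approx_payoff K (candidate m)"
          and v: "\<And>k. int total_size < k \<Longrightarrow> rmem s3 ''v'' k = 0"
        have fr3: "frame X Y s s3" by (rule frame_trans[OF fr2 fr23]) (auto simp: X_def Y_def)
        have s3: "imem s3 ''m'' 0 = int m" "rmem s3 ''cand'' 0 = candidate m"
          "rmem s3 ''b'' = rmem s1 ''b''" "rmem s3 ''best'' = rmem s1 ''best''"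
          using 3 cand frame_imem[OF fr23] frame_rmem[OF fr23] frame_imem[OF fr12] frame_rmem[OF fr12]
          by simp_all
        show "wp I
          (Cond (TAnd (ILe (ICon 1) (iv ''m'')) (RLe (rv ''val'') (rv ''best''))) Skip
            (Seq (rset ''b'' (rv ''cand'')) (rset ''best'' (rv ''val'')))) s3
          (\<lambda>w s'. t + (u + w) \<le> payoff_time n total_size K + 58 \<and> imem s' ''m'' 0 = 0 + int m \<and>
            frame X Y s (iput ''m'' 0 (0 + int m + 1) s') \<and>
            (0 < Suc m \<longrightarrow> best (Suc m) (iput ''m'' 0 (0 + int m + 1) s')) \<and>
            (\<forall>k. int total_size < k \<longrightarrow> rmem (iput ''m'' 0 (0 + int m + 1) s') ''v'' k = 0))"
        proof (cases "0 < m \<and> approx_payoff K (candidate m) \<le> rmem s1 ''best'' 0")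
          case True
          with 3 have "best m s1" by simp
          then have "best (Suc m) (iput ''m'' 0 (0 + int m + 1) s3)"
            using True s3 unfolding best_def less_Suc_eq by auto
          then show ?thesis
            using True t u v val s3 frame_iput[OF _ fr3] by (simp add: wp_Cond wp_Skip X_def)
        next
          case False
          define s4 where "s4 = rput ''best'' 0 (approx_payoff K (candidate m)) (rput ''b'' 0 (candidate m) s3)"
          have "best (Suc m) (iput ''m'' 0 (0 + int m + 1) s4)"
          proof (cases "m = 0")
            case True
            then show ?thesis by (auto simp: best_def s4_def)
          next
            case m: False
            with 3 have "best m s1" by simp
            then obtain m0 where "rmem s1 ''best'' 0 = approx_payoff K (candidate m0)"
              "\<forall>l<m. approx_payoff K (candidate l) \<le> approx_payoff K (candidate m0)"
              unfolding best_def by blast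
            with False m have "\<forall>l<Suc m. approx_payoff K (candidate l) \<le> approx_payoff K (candidate m)"
              unfolding less_Suc_eq by fastforce
            then show ?thesis unfolding best_def by (intro exI[of _ m]) (simp add: s4_def)
          qed
          moreover have "frame X Y s (iput ''m'' 0 (0 + int m + 1) s4)"
            unfolding s4_def using fr3 by (simp add: frame_iput frame_rput X_def Y_def)
          moreover have "rmem s4 ''v'' = rmem s3 ''v''" "imem s4 = imem s3" by (simp_all add: s4_def)
          ultimately show ?thesis
            using False t u v val s3
            by (auto simp: wp_Cond wp_Seq wp_RSet s4_def[symmetric])
        qed
      qed
    qed
  next
    case (4 m s')
    then show ?case using s by (auto simp: frame_imem X_def items_loaded_def)
  next
    case (5 t s')
    then obtain m0 where m0: "rmem s' ''b'' 0 = candidate m0"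
      "\<forall>l<Suc total_size. approx_payoff K (candidate l) \<le> approx_payoff K (candidate m0)"
      unfolding best_def by blast
    show ?case
    proof (rule Q[OF _ m0(1)])
      show "t \<le> (total_size + 1) * (payoff_time n total_size K + 70) + 9"
        using 5 by (simp add: add_ac)
    qed (use m0 in auto)
  qed
qed

lemma wp_totals_prog:
  assumes s: "imem s ''n'' 0 = int n" "\<And>i. i < n \<Longrightarrow> imem s ''a'' (int i) = int (sp_a I i)"
      "\<And>i. i < n \<Longrightarrow> imem s ''d'' (int i) = sp_d I i" "imem s ''A'' 0 = 0" "imem s ''D'' 0 = 0"
    and Q: "\<And>t s'. t \<le> n * 40 + 11 \<Longrightarrow> frame {''i'', ''A'', ''D''} {} s s' \<Longrightarrow>
      imem s' ''A'' 0 = int total_size \<Longrightarrow> imem s' ''D'' 0 = weight \<Longrightarrow> Q t s'"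
  shows "wp I totals_prog s Q"
  unfolding totals_prog_def
proof (rule wp_For[where l = 0 and N = n and T = 26 and Inv =
    "\<lambda>m s'. frame {''i'', ''A'', ''D''} {} s s' \<and> imem s' ''A'' 0 = int (\<Sum>i<m. sp_a I i) \<and>
      imem s' ''D'' 0 = (\<Sum>i<m. \<bar>sp_d I i\<bar>)"], goal_cases)
  case 1
  then show ?case by simp
next
  case 2
  then show ?case using s by (simp add: frame_iput frame_refl)
next
  case (3 m s')
  then have fr: "frame {''i'', ''A'', ''D''} {} s s'" by simp
  show ?case using 3 s frame_imem[OF fr]
    by (auto simp: wp_Seq wp_Cond wp_ISet frame_iput)
next
  case (4 m s')
  then show ?case using s by (auto simp: frame_imem)
next
  case (5 t s')
  then show ?case by (intro Q) (simp_all add: total_size_def weight_def)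
qed

lemma wp_precision_prog:
  assumes s: "rmem s ''eps'' 0 = \<epsilon>" "0 < \<epsilon>" "imem s ''D'' 0 = weight" "imem s ''K'' 0 = 0"
    and Q: "\<And>t s' K. t \<le> K * 20 + 20 \<Longrightarrow> frame {''K''} {} s s' \<Longrightarrow> imem s' ''K'' 0 = int K \<Longrightarrow>
      2 * real_of_int weight < real K * \<epsilon> \<Longrightarrow> real K \<le> 2 * real_of_int weight / \<epsilon> + 1 \<Longrightarrow> Q t s'"
  shows "wp I precision_prog s Q"
proof -
  have "0 \<le> weight" by (simp add: weight_def sum_nonneg)
  then have nonneg: "0 \<le> 2 * real_of_int weight / \<epsilon>" using s by simp
  \<comment> \<open>The least \<open>K\<close> with \<open>2 * weight < K * \<epsilon>\<close>: the
    loop test holds for all smaller numbers and fails at this one, so it is the exact number of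
    iterations.\<close>
  define K where "K = Suc (nat \<lfloor>2 * real_of_int weight / \<epsilon>\<rfloor>)"
  have below: "real k * \<epsilon> \<le> 2 * real_of_int weight" if "k < K" for k
  proof -
    have "int k \<le> \<lfloor>2 * real_of_int weight / \<epsilon>\<rfloor>" using that nonneg unfolding K_def by (simp add: less_Suc_eq_le le_nat_iff)
    then have "real k \<le> 2 * real_of_int weight / \<epsilon>" by (simp add: le_floor_iff)
    then show ?thesis using s by (simp add: field_simps)
  qed
  have K: "real K = real_of_int \<lfloor>2 * real_of_int weight / \<epsilon>\<rfloor> + 1"
    using nonneg by (simp add: K_def of_nat_nat)
  then have "2 * real_of_int weight / \<epsilon> < real K" by linarith
  then have above: "2 * real_of_int weight < real K * \<epsilon>" using s by (simp add: field_simps)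
  show ?thesis
    unfolding precision_prog_def
  proof (rule wp_While[where N = K and T = 6 and Inv =
      "\<lambda>k s'. frame {''K''} {} s s' \<and> imem s' ''K'' 0 = int k"], goal_cases)
    case 1
    then show ?case using s by (simp add: frame_refl)
  next
    case (2 k s')
    then show ?case using s below[of k] by (auto simp: frame_imem frame_rmem wp_ISet frame_iput)
  next
    case (3 s')
    then show ?case using s above by (auto simp: frame_imem frame_rmem)
  next
    case (4 s' t)
    show ?case by (rule Q[of _ K]) (use 4 above K in \<open>auto simp: le_floor_iff\<close>)
  qed
qed

lemma approx_prog_correct:
  assumes "0 < \<epsilon>"
  shows "\<exists>t s' K. exec I approx_prog (sp_input I \<epsilon>) t s' \<and> sp_additive_approx I \<epsilon> (sp_output s') \<and>
    t \<le> approx_time n total_size K \<and> real K \<le> 2 * real_of_int weight / \<epsilon> + 1"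
proof -
  define s where "s = sp_input I \<epsilon>"
  have "wp I approx_prog s (\<lambda>t s'. sp_additive_approx I \<epsilon> (sp_output s') \<and>
    (\<exists>K. t \<le> approx_time n total_size K \<and> real K \<le> 2 * real_of_int weight / \<epsilon> + 1))"
    unfolding approx_prog_def wp_Seq
  proof (rule wp_totals_prog)
    fix t s1
    assume t: "t \<le> n * 40 + 11" and fr1: "frame {''i'', ''A'', ''D''} {} s s1"
      and A: "imem s1 ''A'' 0 = int total_size" and D: "imem s1 ''D'' 0 = weight"
    show "wp I precision_prog s1 (\<lambda>u s'. wp I search_prog s' (\<lambda>w s'.
      sp_additive_approx I \<epsilon> (sp_output s') \<and>
      (\<exists>K. t + (u + w) \<le> approx_time n total_size K \<and> real K \<le> 2 * real_of_int weight / \<epsilon> + 1)))"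
    proof (rule wp_precision_prog[OF _ assms D])
      show "rmem s1 ''eps'' 0 = \<epsilon>" "imem s1 ''K'' 0 = 0"
        using frame_imem[OF fr1] frame_rmem[OF fr1] by (simp_all add: s_def sp_input_def)
      fix u s2 K
      assume u: "u \<le> K * 20 + 20" and fr12: "frame {''K''} {} s1 s2" and K: "imem s2 ''K'' 0 = int K"
        "2 * real_of_int weight < real K * \<epsilon>" "real K \<le> 2 * real_of_int weight / \<epsilon> + 1"
      have fr2: "frame {''i'', ''A'', ''D'', ''K''} {} s s2"
        by (rule frame_trans[OF frame_trans[OF frame_refl fr1] fr12]) auto
      have "0 \<le> weight" by (simp add: weight_def sum_nonneg)
      then have "0 < K" using K(2) by (cases K) auto
      show "wp I search_prog s2 (\<lambda>w s'. sp_additive_approx I \<epsilon> (sp_output s') \<and>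
        (\<exists>K. t + (u + w) \<le> approx_time n total_size K \<and> real K \<le> 2 * real_of_int weight / \<epsilon> + 1))"
      proof (rule wp_search_prog[OF _ K(1) \<open>0 < K\<close>])
        show "items_loaded s2"
          using A frame_imem[OF fr2] frame_imem[OF fr12] by (simp add: items_loaded_def s_def sp_input_def)
        fix w m0 and s3 :: mem
        assume w: "w \<le> (total_size + 1) * (payoff_time n total_size K + 70) + 9"
          and b: "rmem s3 ''b'' 0 = candidate m0"
          and best: "\<And>m. m \<le> total_size \<Longrightarrow> approx_payoff K (candidate m) \<le> approx_payoff K (candidate m0)"
        have "t + (u + w) \<le> approx_time n total_size K"
          using t u w unfolding approx_time_def by linarith
        then show "sp_additive_approx I \<epsilon> (sp_output s3) \<and>
          (\<exists>K. t + (u + w) \<le> approx_time n total_size K \<and> real K \<le> 2 * real_of_int weight / \<epsilon> + 1)"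
          using additive_approx_of_best_candidate[OF K(2) assms best] K(3) b by (auto simp: sp_output_def)
      qed (use frame_rmem[OF fr2] in \<open>simp_all add: s_def sp_input_def\<close>)
    qed
  qed (simp_all add: s_def sp_input_def)
  then show ?thesis unfolding wp_def s_def by blast
qed

end

section \<open>The polynomial time bound\<close>

lemma approx_time_mono:
  fixes n :: real
  assumes "0 \<le> n" "n \<le> n'" "0 \<le> A" "A \<le> A'" "0 \<le> K" "K \<le> K'"
  shows "approx_time n A K \<le> approx_time n' A' K'"
proof -
  have cell: "0 \<le> cell_time A" "cell_time A \<le> cell_time A'"
    using assms by (simp_all add: cell_time_def)
  then have share: "0 \<le> share_time n A" "share_time n A \<le> share_time n' A'"
    using assms unfolding share_time_def by (auto intro!: add_mono mult_mono add_nonneg_nonneg mult_nonneg_nonneg)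
  then have payoff: "0 \<le> payoff_time n A K" "payoff_time n A K \<le> payoff_time n' A' K'"
    using assms unfolding payoff_time_def by (auto intro!: add_mono mult_mono add_nonneg_nonneg mult_nonneg_nonneg)
  then show ?thesis
    using assms unfolding approx_time_def by (auto intro!: add_mono mult_mono add_nonneg_nonneg mult_nonneg_nonneg)
qed

lemma of_nat_approx_time: "real (approx_time n A K) = approx_time (real n) (real A) (real K)"
  by (simp add: approx_time_def payoff_time_def share_time_def cell_time_def algebra_simps)

text \<open>Evaluation at a point is a semiring homomorphism, so the bound read in the polynomial
  ring evaluates to the bound read in the reals; no polynomial has to be multiplied out.\<close>

lemma poly_approx_time: "poly (approx_time p q r) x = approx_time (poly p x) (poly q x) (poly r x :: real)"
  by (simp add: approx_time_def payoff_time_def share_time_def cell_time_def)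

theorem theorem8:
  "\<exists>P. fully_pseudo_poly_additive_scheme {I. sp_valid I \<and> sp_independent I} P"
proof -
  \<comment> \<open>At \<open>X\<close>, the magnitude plus 1/\<epsilon>, the arguments evaluate to
    \<open>X\<close>, \<open>X\<close> and \<open>1 + 2 * X^2\<close>. The last one bounds
    \<open>K\<close>, because \<open>weight\<close> and 1/\<epsilon> are both at most
    \<open>X\<close>.\<close>
  define p :: "real poly" where "p = approx_time [:0, 1:] [:0, 1:] [:1, 0, 2:]"
  have "\<exists>t s. exec I approx_prog (sp_input I \<epsilon>) t s \<and>
      real t \<le> poly p (sp_magnitude I + 1 / \<epsilon>) \<and> sp_additive_approx I \<epsilon> (sp_output s)"
    if I: "sp_valid I" "sp_independent I" and \<epsilon>: "0 < \<epsilon>" for I \<epsilon>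
  proof -
    interpret sp_instance I using I by (rule sp_instance.intro)
    obtain t s K where run: "exec I approx_prog (sp_input I \<epsilon>) t s" "sp_additive_approx I \<epsilon> (sp_output s)"
      and t: "t \<le> approx_time n total_size K" and K: "real K \<le> 2 * real_of_int weight / \<epsilon> + 1"
      using approx_prog_correct[OF \<epsilon>] by blast
    define X where "X = sp_magnitude I + 1 / \<epsilon>"
    have nonneg: "0 \<le> sp_delta I" "0 \<le> sp_bmin I" "0 \<le> sp_bmax I" "0 \<le> 1 / \<epsilon>" "0 \<le> real_of_int weight"
      using I(1) \<epsilon> by (auto simp: sp_valid_def weight_def sum_nonneg)
    have "X = real n + real total_size + real_of_int weight + sp_delta I + sp_bmin I + sp_bmax I + 1 / \<epsilon>"
      by (simp add: X_def sp_magnitude_def total_size_def weight_def)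
    with nonneg have X: "real n \<le> X" "real total_size \<le> X" "real_of_int weight \<le> X" "1 / \<epsilon> \<le> X"
      by linarith+
    have "real_of_int weight * (1 / \<epsilon>) \<le> X * X"
      using X nonneg by (intro mult_mono) auto
    with K have "real K \<le> 1 + 2 * (X * X)" by simp
    have "real t \<le> approx_time (real n) (real total_size) (real K)"
      using t by (simp flip: of_nat_approx_time)
    also have "\<dots> \<le> approx_time X X (1 + 2 * (X * X))"
      using X \<open>real K \<le> 1 + 2 * (X * X)\<close> by (intro approx_time_mono) auto
    also have "\<dots> = poly p X"
      by (simp add: p_def poly_approx_time algebra_simps)
    finally show ?thesis using run X_def by blast
  qed
  then show ?thesis
    unfolding fully_pseudo_poly_additive_scheme_def
    by (intro exI[of _ approx_prog] exI[of _ p]) auto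
qed

end
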